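(* Gaussian elimination (GE) with local maximum volume pivoting is a rank-revealer with $\mu_{m,n,k}=1+5k\sqrt{mn}$ and computes a partial LU factorization satisfying interpolative bounds with $\nu\le 1$. Explicitly: let $m,n\ge 1$, $1\le k\le \min(m,n)$, $A\in\mathbb{R}^{m\times n}$, and let $A_{11}$ be any $k\times k$ local maximum volume submatrix of $A$. Choose permutation matrices $P_1,P_2$ such that $$P_1AP_2=\begin{bmatrix}A_{11}&A_{12}\\ A_{21}&A_{22}\end{bmatrix},$$ and let $$A_k=P_1^{-1}\begin{bmatrix}A_{11}&A_{12}\\ A_{21}&A_{21}A_{11}^{-1}A_{12}\end{bmatrix}P_2^{-1}.$$ Then $\operatorname{rank}(A_k)\le k$ and, with $\mu=1+5k\sqrt{mn}$, $$\frac1\mu\,\sigma_j(A)\le\sigma_j(A_k)\le\mu\,\sigma_j(A),\qquad 1\le j\le k,$$ $$\frac1\mu\,\sigma_{k+j}(A)\le\sigma_j(A-A_k)\le\mu\,\sigma_{k+j}(A),\qquad 1\le j\le\min(m,n)-k,$$ and moreover $\|A_{21}A_{11}^{-1}\|_{\max}\le 1$ and $\|A_{11}^{-1}A_{12}\|_{\max}\le 1$.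
   Context: $\sigma_1(M)\ge\sigma_2(M)\ge\cdots\ge 0$ denote the singular values of a real matrix $M$, and $\|M\|_{\max}$ is the maximum absolute value of its entries (equal to $0$ for an empty matrix). The volume of $M\in\mathbb{R}^{p\times q}$ is $\mathrm{vol}(M)=\prod_{j=1}^{\min(p,q)}\sigma_j(M)$ (so $|\det M|$ if $M$ is square). A $p\times q$ submatrix of $A$ is specified by a set of $p$ row indices and a set of $q$ column indices. A $p\times q$ submatrix $B$ of $A$ is a local maximum volume submatrix if $\mathrm{vol}(B)>0$ and $\mathrm{vol}(B)\ge\mathrm{vol}(\hat B)$ for all $p\times q$ submatrices $\hat B$ of $A$ that differ from $B$ in at most one row and at most one column (i.e. at most one row index is replaced and at most one column index is replaced). GE with local maximum volume pivoting selects a $k\times k$ local maximum volume submatrix $A_{11}$ of $A$ as its pivot and forms the partial LU factorization $$P_1AP_2=\begin{bmatrix}I_k&0\\ A_{21}A_{11}^{-1}&I_{m-k}\end{bmatrix}\begin{bmatrix}A_{11}&A_{12}\\0&S(A_{11})\end{bmatrix},\qquad S(A_{11})=A_{22}-A_{21}A_{11}^{-1}A_{12}.$$ An algorithm is a rank-revealer with factor $\mu_{m,n,k}\ge1$ (bounded by a polynomial in $m,n,k$ and not depending on $A$) if it computes a matrix $A_k$ of rank at most $k$ satisfying the two displayed families of singular value inequalities. The partial LU factorization satisfies interpolative bounds with $\nu\ge 0$ if $\|A_{21}A_{11}^{-1}\|_{\max}\le\nu$ and $\|A_{11}^{-1}A_{12}\|_{\max}\le\nu$. *)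

theory Defs
  imports
    Complex_Main
    "HOL-Combinatorics.Permutations"
    "HOL-Computational_Algebra.Polynomial"
    "Jordan_Normal_Form.Char_Poly"
    "Jordan_Normal_Form.Gauss_Jordan_Elimination"
    "Jordan_Normal_Form.DL_Submatrix"
    "Jordan_Normal_Form.DL_Rank"
begin

text \<open>
  All rows and columns are indexed from 0, as in \<^const>\<open>carrier_mat\<close>; singular values are
  indexed from 1.
\<close>

text \<open>
  The list of square roots of the eigenvalues of \<open>M\<^sup>T M\<close>, in decreasing order.
  Multiplicities are those of the roots of the characteristic polynomial. As \<open>M\<^sup>T M\<close> is real
  symmetric positive semidefinite, the list has \<^term>\<open>dim_col M\<close> entries.
\<close>
definition sing_vals :: "real mat \<Rightarrow> real list" where
  "sing_vals M =
     map sqrt (rev (sorted_list_of_multiset (proots (char_poly (transpose_mat M * M)))))"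

text \<open>
  There are \<^term>\<open>min (dim_row M) (dim_col M)\<close> singular values; the remaining entries of
  \<^term>\<open>sing_vals M\<close> are zero.
\<close>
definition sing_val :: "real mat \<Rightarrow> nat \<Rightarrow> real" where
  "sing_val M j =
     (if 1 \<le> j \<and> j \<le> min (dim_row M) (dim_col M) then sing_vals M ! (j - 1) else 0)"

definition max_norm :: "real mat \<Rightarrow> real" where
  "max_norm M = (if elements_mat M = {} then 0 else Max (abs ` elements_mat M))"

definition vol :: "real mat \<Rightarrow> real" where
  "vol M = (\<Prod>j = 1..min (dim_row M) (dim_col M). sing_val M j)"

text \<open>
  A submatrix is given by its sets \<open>I\<close>, \<open>J\<close> of row and column indices. For index sets of equal
  (finite) size, \<open>card (I' - I) \<le> 1\<close> says that at most one index of \<open>I\<close> is replaced.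
\<close>
definition local_max_vol :: "real mat \<Rightarrow> nat set \<Rightarrow> nat set \<Rightarrow> bool" where
  "local_max_vol A I J \<longleftrightarrow>
     I \<subseteq> {..<dim_row A} \<and> J \<subseteq> {..<dim_col A} \<and>
     vol (submatrix A I J) > 0 \<and>
     (\<forall>I' J'. I' \<subseteq> {..<dim_row A} \<longrightarrow> J' \<subseteq> {..<dim_col A} \<longrightarrow>
        card I' = card I \<longrightarrow> card J' = card J \<longrightarrow>
        card (I' - I) \<le> 1 \<longrightarrow> card (J' - J) \<le> 1 \<longrightarrow>
        vol (submatrix A I' J') \<le> vol (submatrix A I J))"

text \<open>
  Row \<open>i\<close> of \<open>perm_mat m p * A\<close> is row \<open>p i\<close> of \<open>A\<close>, and column \<open>j\<close> of
  \<open>A * transpose_mat (perm_mat n q)\<close> is column \<open>q j\<close> of \<open>A\<close>.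
\<close>
definition perm_mat :: "nat \<Rightarrow> (nat \<Rightarrow> nat) \<Rightarrow> real mat" where
  "perm_mat n p = mat n n (\<lambda>(i, j). if j = p i then 1 else 0)"

text \<open>The inverse of an invertible square matrix; unspecified for other matrices.\<close>
definition mat_inv :: "real mat \<Rightarrow> real mat" where
  "mat_inv A = the (mat_inverse A)"

end

theory Submission
  imports
    Defs
    "Jordan_Normal_Form.Schur_Decomposition"
    "HOL-Analysis.L2_Norm"
begin

text \<open>
  Write \<open>B\<close> for the permuted matrix with blocks \<open>A11\<close>, \<open>A12\<close>, \<open>A21\<close>, \<open>A22\<close>, put \<open>G\<close> for the inverse of
  \<open>A11\<close>, \<open>X = G * A12\<close>, \<open>Y = A21 * G\<close>, and let \<open>S = A22 - A21 * G * A12\<close> be the Schur complement.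
  Up to the permutations, which leave singular values unchanged, \<open>Ak\<close> is the matrix \<open>C\<close> obtained from
  \<open>B\<close> by replacing \<open>A22\<close> with \<open>A21 * G * A12\<close>, and \<open>A - Ak\<close> is \<open>E = B - C\<close>, whose only nonzero
  block is \<open>S\<close>.

  Local maximality enters through determinants. Since volume is \<open>\<bar>det\<bar>\<close> for square matrices,
  Cramer's rule shows that replacing one row of the pivot multiplies its volume by the absolute value
  of an entry of \<open>Y\<close>, and replacing one column by that of an entry of \<open>X\<close>; hence these entries are at
  most 1 in absolute value. Replacing row \<open>r\<close> and column \<open>t\<close> at once multiplies the determinant by
  \<open>Y(i,r) X(t,j) + S(i,j) G(t,r)\<close> (\<open>det_exchange_row_col\<close>). As this also has absolute value at most 1,
  \<open>\<bar>S(i,j)\<bar> \<bar>G(t,r)\<bar> \<le> 2\<close> for all indices: the largest entries of \<open>S\<close> and \<open>G\<close> have product at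
  most 2 (\<open>max_norm_bounds_of_local_max_vol\<close>).

  For the singular values, let \<open>a\<close>, \<open>b\<close>, \<open>s\<close>, \<open>g\<close> bound the operator norms of \<open>Y\<close>, \<open>X\<close>, \<open>S\<close>, \<open>G\<close>. Four
  inequalities follow from the min-max characterisation, used in the form of \<open>sing_val_le\<close> and
  \<open>sing_val_ge\<close>; the last one is the substantial one.

  \<^item> \<open>C\<close> has rank at most \<open>k\<close>, so \<open>\<sigma>\<^sub>k\<^sub>+\<^sub>j(B) \<le> \<sigma>\<^sub>j(E)\<close>.

  \<^item> \<open>C (u, w) = B (u + X w, 0)\<close>, so \<open>\<sigma>\<^sub>j(C) \<le> (1 + b) \<sigma>\<^sub>j(B)\<close>.

  \<^item> \<open>B = C + E\<close> and \<open>\<sigma>\<^sub>k(C) \<ge> 1 / g\<close>, so \<open>\<sigma>\<^sub>j(B) \<le> \<sigma>\<^sub>j(C) + s \<le> (1 + s g) \<sigma>\<^sub>j(C)\<close> for \<open>j \<le> k\<close>.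

  \<^item> \<open>B (x - X y, y) = (A11 x, Y A11 x + S y)\<close>; letting \<open>y\<close> range over a \<open>j\<close>-dimensional space on which
    \<open>S\<close> is bounded below by \<open>\<sigma>\<^sub>j(E)\<close>, and \<open>x\<close> over the whole space, gives
    \<open>\<sigma>\<^sub>j(E) \<le> (s g + (1 + b) (1 + a)) \<sigma>\<^sub>k\<^sub>+\<^sub>j(B)\<close>.

  An \<open>r \<times> c\<close> matrix with entries bounded by \<open>e\<close> has operator norm at most \<open>e \<surd>(r c)\<close>. So with
  \<open>\<theta> = k \<surd>(m n)\<close> one gets \<open>a, b, a b \<le> \<theta>\<close> and \<open>s g \<le> 2 \<theta>\<close>, and every factor above is at most
  \<open>1 + 5 \<theta>\<close>.
\<close>

section \<open>Diagonalisation of real symmetric matrices\<close>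

lemma extend_to_orthogonal_mat:
  fixes v :: "real vec"
  assumes v: "v \<in> carrier_vec n" and v0: "v \<noteq> 0\<^sub>v n"
  obtains W c where "W \<in> carrier_mat n n" "transpose_mat W * W = 1\<^sub>m n" "col W 0 = c \<cdot>\<^sub>v v"
    "(c::real) \<noteq> 0"
proof -
  interpret cof_vec_space n "TYPE(real)" .
  define b where "b = basis_completion v"
  define ws where "ws = gram_schmidt n b"
  have n0: "n \<noteq> 0"
    using v v0 by (auto intro: eq_vecI)
  note bc = basis_completion[OF v v0, folded b_def]
  obtain vs where bv: "b = v # vs"
    using bc(6,7) n0 by (cases b) auto
  note gs = gram_schmidt_result[OF bc(2,4,5) ws_def]
  have hdws: "ws ! 0 = v"
    using gram_schmidt_hd[OF v, of vs, folded bv, folded ws_def] gs(4) bc(6) n0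
    by (cases ws) auto
  have len: "length ws = n"
    using gs(4) bc(6) by simp
  have wc: "ws ! i \<in> carrier_vec n" if "i < n" for i
    using gs(3) len that by auto
  have orth: "ws ! i \<bullet> ws ! j = 0 \<longleftrightarrow> i \<noteq> j" if "i < n" "j < n" for i j
    using gs(2) that len unfolding corthogonal_def by auto
  define N where "N i = sqrt (ws ! i \<bullet> ws ! i)" for i
  have N0: "N i \<noteq> 0" "N i * N i = ws ! i \<bullet> ws ! i" if "i < n" for i
  proof -
    have "ws ! i \<bullet> ws ! i \<ge> 0"
      unfolding scalar_prod_def by (auto intro: sum_nonneg)
    then show "N i \<noteq> 0" "N i * N i = ws ! i \<bullet> ws ! i"
      using orth[OF that that] unfolding N_def by auto
  qed
  define W where "W = mat n n (\<lambda>(i, j). (1 / N j) * (ws ! j $ i))"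
  have colW: "col W j = (1 / N j) \<cdot>\<^sub>v ws ! j" if "j < n" for j
    using that wc[OF that] by (intro eq_vecI) (auto simp: W_def)
  have W: "W \<in> carrier_mat n n"
    by (simp add: W_def)
  have "transpose_mat W * W = 1\<^sub>m n"
  proof (rule eq_matI)
    fix i j assume ij: "i < dim_row (1\<^sub>m n)" "j < dim_col (1\<^sub>m n)"
    then have "(transpose_mat W * W) $$ (i, j) = col W i \<bullet> col W j"
      using W by simp
    also have "\<dots> = (1 / N i) * ((1 / N j) * (ws ! i \<bullet> ws ! j))"
      using ij wc[of i] wc[of j] by (simp add: colW)
    also have "\<dots> = 1\<^sub>m n $$ (i, j)"
      using ij orth[of i j] N0[of i] by (cases "i = j") (auto simp flip: N0(2))
    finally show "(transpose_mat W * W) $$ (i, j) = 1\<^sub>m n $$ (i, j)" .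
  qed (use W in auto)
  moreover have "col W 0 = (1 / N 0) \<cdot>\<^sub>v v" "1 / N 0 \<noteq> 0"
    using colW[of 0] hdws n0 N0[of 0] by auto
  ultimately show ?thesis
    using that W by blast
qed

text \<open>
  Induction by deflation: a unit eigenvector for the first root is completed to an orthogonal matrix
  \<open>W\<close>, and symmetry makes \<open>transpose_mat W * A * W\<close> block diagonal. The prescribed order of the roots
  is kept, so that a sorted list of roots yields a sorted diagonal.
\<close>
lemma symmetric_diagonalisation:
  fixes A :: "real mat"
  assumes "A \<in> carrier_mat n n" "transpose_mat A = A"
    and "char_poly A = (\<Prod>e\<leftarrow>es. [:- e, 1:])"
  shows "\<exists>Q \<in> carrier_mat n n. transpose_mat Q * Q = 1\<^sub>m n \<and> length es = n \<and>
    A * Q = Q * mat n n (\<lambda>(i, j). if i = j then es ! i else 0)"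
  using assms
proof (induction es arbitrary: n A)
  case Nil
  then have "n = 0"
    using degree_monic_char_poly[of A n] by auto
  then show ?case
    using Nil by (intro bexI[of _ "1\<^sub>m 0"]) auto
next
  case (Cons e es n A)
  note A = Cons.prems(1) and sym = Cons.prems(2)
  have mon: "monic (\<Prod>e\<leftarrow>es. [:- e, 1:])"
    by (rule monic_prod_list) auto
  have "degree (char_poly A) = Suc (degree (\<Prod>e\<leftarrow>es. [:- e, 1:]))"
    unfolding Cons.prems(3) list.map prod_list.Cons
    by (subst degree_mult_eq) (use mon in auto)
  then have n0: "n \<noteq> 0"
    using degree_monic_char_poly[OF A] by auto
  then obtain n1 where n: "n = 1 + n1"
    by (cases n) auto
  have "eigenvalue A e"
    unfolding eigenvalue_root_char_poly[OF A] Cons.prems(3) by simp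
  then obtain v where v: "v \<in> carrier_vec n" "v \<noteq> 0\<^sub>v n" "A *\<^sub>v v = e \<cdot>\<^sub>v v"
    using A unfolding eigenvalue_def eigenvector_def by auto
  obtain W c where W: "W \<in> carrier_mat n n" "transpose_mat W * W = 1\<^sub>m n"
    and W0: "col W 0 = c \<cdot>\<^sub>v v" "c \<noteq> 0"
    using extend_to_orthogonal_mat[OF v(1,2)] .
  have WT: "transpose_mat W \<in> carrier_mat n n"
    using W by simp
  have WWT: "W * transpose_mat W = 1\<^sub>m n"
    using mat_mult_left_right_inverse[OF WT W(1) W(2)] .
  define B where "B = transpose_mat W * A * W"
  have B: "B \<in> carrier_mat n n"
    using W A by (simp add: B_def)
  have AW: "A * W \<in> carrier_mat n n"
    using A W by simp
  have B': "B = transpose_mat W * (A * W)"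
    using assoc_mult_mat[OF WT A W(1)] by (simp add: B_def)
  have symB: "transpose_mat B = B"
    unfolding B' transpose_mult[OF WT AW] transpose_mult[OF A W(1)] sym
    using assoc_mult_mat[OF WT A W(1)] by simp
  have WB: "W * B = A * W"
    using assoc_mult_mat[OF W(1) WT AW] unfolding WWT B' left_mult_one_mat[OF AW] by simp
  \<comment> \<open>by orthogonality of \<open>W\<close>, its first column, a multiple of \<open>v\<close>, is sent to \<open>e\<close> times the first unit vector\<close>
  have col0: "col B 0 = e \<cdot>\<^sub>v unit_vec n 0"
  proof -
    have "col B 0 = transpose_mat W *\<^sub>v (A *\<^sub>v col W 0)"
      using n0 unfolding B' by (simp only: col_mult2[OF WT AW] col_mult2[OF A W(1)])
    also have "A *\<^sub>v col W 0 = e \<cdot>\<^sub>v col W 0"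
      using W0 v A by (simp add: mult_mat_vec[of _ n n] smult_smult_assoc mult.commute)
    also have "transpose_mat W *\<^sub>v (e \<cdot>\<^sub>v col W 0) = e \<cdot>\<^sub>v (transpose_mat W *\<^sub>v col W 0)"
      using W n0 by (simp add: mult_mat_vec[of _ n n])
    also have "transpose_mat W *\<^sub>v col W 0 = unit_vec n 0"
      using col_mult2[OF WT W(1), of 0] n0 unfolding W(2) by simp
    finally show ?thesis .
  qed
  have B0: "B $$ (i, 0) = (if i = 0 then e else 0)" "B $$ (0, i) = (if i = 0 then e else 0)"
    if "i < n" for i
  proof -
    show *: "B $$ (i, 0) = (if i = 0 then e else 0)"
      using arg_cong[OF col0, of "\<lambda>u. u $ i"] that B n0 by auto
    show "B $$ (0, i) = (if i = 0 then e else 0)"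
      using * that B n0 by (subst symB[symmetric]) auto
  qed
  define C where "C = mat n1 n1 (\<lambda>(i, j). B $$ (Suc i, Suc j))"
  have C: "C \<in> carrier_mat n1 n1"
    by (simp add: C_def)
  define E where "E = mat 1 1 (\<lambda>_. e)"
  have E: "E \<in> carrier_mat 1 1"
    by (simp add: E_def)
  \<comment> \<open>the first row vanishes off the diagonal because the first column does and \<open>B\<close> is symmetric\<close>
  have blk: "B = four_block_mat E (0\<^sub>m 1 n1) (0\<^sub>m n1 1) C"
    using B B0 n by (intro eq_matI) (auto simp: C_def E_def)
  have "A = W * B * transpose_mat W"
    unfolding WB assoc_mult_mat[OF A W(1) WT] WWT right_mult_one_mat[OF A] by simp
  then have "similar_mat_wit A B W (transpose_mat W)"
    by (intro similar_mat_witI[OF WWT W(2)]) (use W A B WT in auto)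
  then have "char_poly B = char_poly A"
    using char_poly_similar[of A B] unfolding similar_mat_def by metis
  moreover have "char_poly B = char_poly E * char_poly C"
    unfolding blk by (rule char_poly_four_block_zeros_col[OF E _ C]) simp
  moreover have "char_poly E = [:- e, 1:]"
    by (simp add: E_def char_poly_defs det_def sign_def)
  ultimately have "[:- e, 1:] * char_poly C = [:- e, 1:] * (\<Prod>e\<leftarrow>es. [:- e, 1:])"
    using Cons.prems(3) by simp
  then have cpC: "char_poly C = (\<Prod>e\<leftarrow>es. [:- e, 1:])"
    by (metis mult_cancel_left pCons_eq_0_iff zero_neq_one)
  have symC: "transpose_mat C = C"
  proof (rule eq_matI)
    fix i j assume ij: "i < dim_row C" "j < dim_col C"
    then have "transpose_mat B $$ (Suc i, Suc j) = B $$ (Suc j, Suc i)"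
      using B n C by auto
    then show "transpose_mat C $$ (i, j) = C $$ (i, j)"
      using ij C by (simp add: C_def symB)
  qed (use C in auto)
  obtain R where R: "R \<in> carrier_mat n1 n1" "transpose_mat R * R = 1\<^sub>m n1" "length es = n1"
    "C * R = R * mat n1 n1 (\<lambda>(i, j). if i = j then es ! i else 0)"
    using Cons.IH[OF C symC cpC] by blast
  define D where "D = mat n1 n1 (\<lambda>(i, j). if i = j then es ! i else 0)"
  have D: "D \<in> carrier_mat n1 n1"
    by (simp add: D_def)
  define R' where "R' = four_block_mat (1\<^sub>m 1) (0\<^sub>m 1 n1) (0\<^sub>m n1 1) R"
  have R': "R' \<in> carrier_mat n n"
    unfolding R'_def n using R by (intro four_block_carrier_mat) auto
  define D' where "D' = four_block_mat E (0\<^sub>m 1 n1) (0\<^sub>m n1 1) D"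
  have D'eq: "D' = mat n n (\<lambda>(i, j). if i = j then (e # es) ! i else 0)"
    unfolding D'_def using n by (intro eq_matI) (auto simp: D_def E_def)
  have D': "D' \<in> carrier_mat n n"
    by (simp add: D'eq)
  have "transpose_mat R' * R' = four_block_mat (1\<^sub>m 1) (0\<^sub>m 1 n1) (0\<^sub>m n1 1) (1\<^sub>m n1)"
    unfolding R'_def using R
    by (simp add: transpose_four_block_mat[of _ 1 1 _ n1 _ n1]
        mult_four_block_mat[of _ 1 1 _ n1 _ n1 _ _ 1 _ n1])
  then have oR: "transpose_mat R' * R' = 1\<^sub>m n"
    unfolding n by (simp only: four_block_one_mat)
  have eR: "B * R' = R' * D'"
    unfolding blk R'_def D'_def using R(1,4) C D E
    by (simp add: mult_four_block_mat[of _ 1 1 _ n1 _ n1 _ _ 1 _ n1] D_def)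
  have WR: "W * R' \<in> carrier_mat n n"
    using W R' by simp
  have R'T: "transpose_mat R' \<in> carrier_mat n n"
    using R' by simp
  have "transpose_mat (W * R') * (W * R') = transpose_mat R' * (transpose_mat W * (W * R'))"
    unfolding transpose_mult[OF W(1) R'] by (rule assoc_mult_mat[OF R'T WT WR])
  also have "transpose_mat W * (W * R') = R'"
    using assoc_mult_mat[OF WT W(1) R'] unfolding W(2) left_mult_one_mat[OF R'] by simp
  finally have o: "transpose_mat (W * R') * (W * R') = 1\<^sub>m n"
    using oR by simp
  have "A * (W * R') = (A * W) * R'"
    using assoc_mult_mat[OF A W(1) R'] by simp
  also have "\<dots> = W * (B * R')"
    unfolding WB[symmetric] by (rule assoc_mult_mat[OF W(1) B R'])
  also have "\<dots> = (W * R') * D'"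
    unfolding eR by (rule assoc_mult_mat[OF W(1) R' D', symmetric])
  finally show ?case
    using o WR R(3) n unfolding D'eq by (intro bexI[of _ "W * R'"]) auto
qed

text \<open>
  Over the complex numbers the characteristic polynomial splits, and each root \<open>a\<close> is real: for an
  eigenvector \<open>v\<close>, moving the symmetric matrix across the Hermitian product turns \<open>a (v \<bullet>c v)\<close> into
  its own conjugate.
\<close>
lemma symmetric_char_poly_splits:
  fixes A :: "real mat"
  assumes A: "A \<in> carrier_mat n n" and sym: "transpose_mat A = A"
  obtains es where "char_poly A = (\<Prod>e\<leftarrow>es. [:- e, 1:])"
proof -
  define CA where "CA = map_mat complex_of_real A"
  have CA: "CA \<in> carrier_mat n n"
    using A by (simp add: CA_def)
  obtain as where as: "char_poly CA = (\<Prod>a\<leftarrow>as. [:- a, 1:])"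
    using char_poly_factorized[OF CA] by auto
  have real: "complex_of_real (Re a) = a" if "a \<in> set as" for a
  proof -
    have "poly (char_poly CA) a = 0"
      unfolding as using that by (induction as) auto
    then have "eigenvalue CA a"
      using eigenvalue_root_char_poly[OF CA] by simp
    then obtain v where v: "v \<in> carrier_vec n" "v \<noteq> 0\<^sub>v n" "CA *\<^sub>v v = a \<cdot>\<^sub>v v"
      using CA unfolding eigenvalue_def eigenvector_def by auto
    have symC: "transpose_mat CA = CA"
      using sym unfolding CA_def by (metis map_mat_transpose)
    have cv: "conjugate v \<in> carrier_vec n"
      using v by simp
    have cAv: "CA *\<^sub>v conjugate v = conjugate (CA *\<^sub>v v)"
      using A v(1)
      by (intro eq_vecI) (auto simp: CA_def scalar_prod_def conjugate_complex_def)
    have "a * (v \<bullet>c v) = (CA *\<^sub>v v) \<bullet>c v"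
      using v cv by simp
    also have "\<dots> = v \<bullet> (CA *\<^sub>v conjugate v)"
      using transpose_vec_mult_scalar[OF CA cv v(1)] CA v cv symC
      by (metis comm_scalar_prod mult_mat_vec_carrier)
    also have "\<dots> = cnj a * (v \<bullet>c v)"
      unfolding cAv v(3) using v cv by (simp add: conjugate_smult_vec conjugate_complex_def)
    finally have "a = cnj a"
      using v(1,2) by simp
    then show ?thesis
      by (metis Reals_cnj_iff of_real_Re)
  qed
  have hom: "comm_ring_hom complex_of_real" "inj_comm_ring_hom complex_of_real"
    by unfold_locales auto
  interpret h: inj_comm_ring_hom complex_of_real
    by (fact hom(2))
  interpret hp: map_poly_inj_comm_ring_hom complex_of_real ..
  have "map_poly complex_of_real (char_poly A) = (\<Prod>a\<leftarrow>as. [:- a, 1:])"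
    using as comm_ring_hom.char_poly_hom[OF hom(1) A] by (simp add: CA_def)
  also have "\<dots> = map_poly complex_of_real (\<Prod>e\<leftarrow>map Re as. [:- e, 1:])"
    using real by (induction as) (auto simp: hp.hom_mult simp del: mult_pCons_left)
  finally show ?thesis
    using that hp.injectivity by blast
qed

section \<open>The Euclidean norm\<close>

definition vnorm :: "real vec \<Rightarrow> real" where
  "vnorm v = sqrt (v \<bullet> v)"

lemma scalar_prod_self: "v \<bullet> v = (\<Sum>i<dim_vec v. (v $ i)\<^sup>2)" for v :: "real vec"
  by (simp add: scalar_prod_def power2_eq_square atLeast0LessThan)

lemma vnorm_L2_set: "vnorm v = L2_set (($) v) {..<dim_vec v}"
  by (simp add: vnorm_def scalar_prod_self L2_set_def)

lemma vnorm_nonneg [simp]: "0 \<le> vnorm v"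
  by (simp add: vnorm_L2_set)

lemma vnorm_power2: "(vnorm v)\<^sup>2 = v \<bullet> v"
  unfolding vnorm_def scalar_prod_self by (simp add: sum_nonneg)

lemma vnorm_eq_0_iff: "v \<in> carrier_vec n \<Longrightarrow> vnorm v = 0 \<longleftrightarrow> v = 0\<^sub>v n"
  unfolding vnorm_L2_set by (auto simp: L2_set_eq_0_iff intro!: eq_vecI)

lemma vnorm_pos: "v \<in> carrier_vec n \<Longrightarrow> v \<noteq> 0\<^sub>v n \<Longrightarrow> 0 < vnorm v"
  using vnorm_eq_0_iff[of v n] vnorm_nonneg[of v] by (metis less_eq_real_def)

lemma vnorm_triangle:
  assumes "u \<in> carrier_vec n" "v \<in> carrier_vec n"
  shows "vnorm (u + v) \<le> vnorm u + vnorm v"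
proof -
  have "vnorm (u + v) = L2_set (\<lambda>i. u $ i + v $ i) {..<n}"
    using assms unfolding vnorm_L2_set by (intro L2_set_cong) auto
  also have "\<dots> \<le> L2_set (($) u) {..<n} + L2_set (($) v) {..<n}"
    by (rule L2_set_triangle_ineq)
  finally show ?thesis
    using assms unfolding vnorm_L2_set by auto
qed

lemma vnorm_triangle_minus:
  assumes "u \<in> carrier_vec n" "v \<in> carrier_vec n"
  shows "vnorm (u - v) \<le> vnorm u + vnorm v"
proof -
  have "vnorm (- v) = vnorm v"
    unfolding vnorm_L2_set L2_set_def using assms by simp
  moreover have "u - v = u + - v"
    using assms by auto
  ultimately show ?thesis
    using vnorm_triangle[of u n "- v"] assms by auto
qed

lemma vnorm_append_power2:
  "(vnorm (u @\<^sub>v w))\<^sup>2 = (vnorm u)\<^sup>2 + (vnorm w)\<^sup>2"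
  unfolding vnorm_power2
  by (rule scalar_prod_append[OF carrier_vec_dim_vec carrier_vec_dim_vec
      carrier_vec_dim_vec carrier_vec_dim_vec])

lemma vnorm_append_ge: "vnorm u \<le> vnorm (u @\<^sub>v w)" "vnorm w \<le> vnorm (u @\<^sub>v w)"
  by (rule power2_le_imp_le; simp add: vnorm_append_power2)+

lemma vnorm_append_le: "vnorm (u @\<^sub>v w) \<le> vnorm u + vnorm w"
  by (rule power2_le_imp_le) (simp_all add: vnorm_append_power2 power2_sum)

lemma vnorm_append_zero: "vnorm (u @\<^sub>v 0\<^sub>v l) = vnorm u" "vnorm (0\<^sub>v l @\<^sub>v u) = vnorm u"
proof -
  have "vnorm (0\<^sub>v l) = 0"
    by (simp add: vnorm_eq_0_iff[of _ l])
  then show "vnorm (u @\<^sub>v 0\<^sub>v l) = vnorm u" "vnorm (0\<^sub>v l @\<^sub>v u) = vnorm u"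
    using vnorm_append_power2[of u "0\<^sub>v l"] vnorm_append_power2[of "0\<^sub>v l" u] by simp_all
qed

text \<open>
  Cauchy-Schwarz in each row: the operator norm is at most the Frobenius norm of a matrix all of
  whose entries equal \<open>e\<close>.
\<close>
lemma vnorm_mult_mat_vec_le:
  assumes M: "M \<in> carrier_mat r c" and x: "x \<in> carrier_vec c"
    and e: "\<And>i j. i < r \<Longrightarrow> j < c \<Longrightarrow> \<bar>M $$ (i, j)\<bar> \<le> e" and e0: "0 \<le> e"
  shows "vnorm (M *\<^sub>v x) \<le> e * sqrt (real r * real c) * vnorm x"
proof -
  have row: "\<bar>(M *\<^sub>v x) $ i\<bar> \<le> e * sqrt (real c) * vnorm x" if i: "i < r" for i
  proof -
    have "(M *\<^sub>v x) $ i = (\<Sum>j<c. M $$ (i, j) * x $ j)"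
      using M x i by (simp add: scalar_prod_def atLeast0LessThan)
    then have "\<bar>(M *\<^sub>v x) $ i\<bar> \<le> (\<Sum>j<c. \<bar>M $$ (i, j)\<bar> * \<bar>x $ j\<bar>)"
      by (simp add: sum_abs[THEN order_trans] abs_mult)
    also have "\<dots> \<le> (\<Sum>j<c. \<bar>e\<bar> * \<bar>x $ j\<bar>)"
      using e[OF i] e0 by (intro sum_mono mult_right_mono) auto
    also have "\<dots> \<le> L2_set (\<lambda>_. e) {..<c} * L2_set (($) x) {..<c}"
      by (rule L2_set_mult_ineq)
    also have "\<dots> = e * sqrt (real c) * vnorm x"
      using x e0 by (simp add: L2_set_constant vnorm_L2_set)
    finally show ?thesis .
  qed
  have "vnorm (M *\<^sub>v x) = L2_set (\<lambda>i. \<bar>(M *\<^sub>v x) $ i\<bar>) {..<r}"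
    using M by (simp add: vnorm_L2_set L2_set_def)
  also have "\<dots> \<le> L2_set (\<lambda>_. e * sqrt (real c) * vnorm x) {..<r}"
    using row by (intro L2_set_mono) auto
  also have "\<dots> = e * sqrt (real r * real c) * vnorm x"
    using e0 by (simp add: L2_set_constant real_sqrt_mult)
  finally show ?thesis .
qed


section \<open>Min-max characterisation of singular values\<close>

text \<open>
  Padding with zero rows gives a square matrix whose transpose kills a unit vector, so it is singular.
\<close>
lemma wide_mat_kernel:
  fixes W :: "real mat"
  assumes W: "W \<in> carrier_mat r c" and "r < c"
  obtains x where "x \<in> carrier_vec c" "x \<noteq> 0\<^sub>v c" "W *\<^sub>v x = 0\<^sub>v r"
proof -
  define P where "P = mat c c (\<lambda>(i, j). if i < r then W $$ (i, j) else 0)"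
  have P: "P \<in> carrier_mat c c"
    by (simp add: P_def)
  have "transpose_mat P *\<^sub>v unit_vec c r = 0\<^sub>v c"
    using assms by (intro eq_vecI) (auto simp: P_def)
  moreover have "unit_vec c r \<noteq> (0\<^sub>v c :: real vec)"
    using assms(2) by (metis index_unit_vec(1) index_zero_vec(1) zero_neq_one)
  ultimately have "det (transpose_mat P) = 0"
    using det_0_iff_vec_prod_zero_field[of "transpose_mat P" c] P
    by (auto intro!: exI[of _ "unit_vec c r"])
  then obtain x where x: "x \<in> carrier_vec c" "x \<noteq> 0\<^sub>v c" "P *\<^sub>v x = 0\<^sub>v c"
    using det_0_iff_vec_prod_zero_field[OF P] det_transpose[OF P] by auto
  have "W *\<^sub>v x = 0\<^sub>v r"
  proof (rule eq_vecI)
    fix i assume "i < dim_vec (0\<^sub>v r :: real vec)"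
    moreover from this have "row W i = row P i"
      using W assms(2) by (intro eq_vecI) (auto simp: P_def)
    ultimately show "(W *\<^sub>v x) $ i = 0\<^sub>v r $ i"
      using W P assms(2) arg_cong[OF x(3), of "\<lambda>v. v $ i"] by simp
  qed (use W in simp)
  then show ?thesis
    using that x by blast
qed

lemma sing_vals_eigenbasis:
  assumes M: "M \<in> carrier_mat m n"
  obtains Q es where "Q \<in> carrier_mat n n" "transpose_mat Q * Q = 1\<^sub>m n"
    "transpose_mat M * M * Q = Q * mat n n (\<lambda>(i, j). if i = j then es ! i else 0)"
    "sing_vals M = map sqrt es" "length es = n" "sorted (rev es)"
proof -
  define B where "B = transpose_mat M * M"
  have B: "B \<in> carrier_mat n n"
    using M by (simp add: B_def)
  have symB: "transpose_mat B = B"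
    using M by (simp add: B_def transpose_mult[of _ n m])
  obtain es0 where es0: "char_poly B = (\<Prod>e\<leftarrow>es0. [:- e, 1:])"
    using symmetric_char_poly_splits[OF B symB] .
  define es where "es = rev (sort es0)"
  have ms: "mset es = mset es0"
    by (simp add: es_def)
  have cp: "char_poly B = (\<Prod>e\<leftarrow>es. [:- e, 1:])"
    unfolding es0 using ms by (metis mset_map prod_mset_prod_list)
  have "proots (\<Prod>e\<leftarrow>l. [:- e, 1:]) = mset l" for l :: "real list"
  proof (induction l)
    case (Cons a l)
    have "(\<Prod>e\<leftarrow>l. [:- e, 1:]) \<noteq> 0"
      by (auto simp: prod_list_zero_iff)
    then show ?case
      using Cons by (simp add: proots_mult del: mult_pCons_left)
  qed simp
  then have sv: "sing_vals M = map sqrt es"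
    unfolding sing_vals_def B_def[symmetric] es0 by (simp add: es_def)
  have "sorted (rev es)"
    by (simp add: es_def)
  then show ?thesis
    using symmetric_diagonalisation[OF B symB cp] sv that unfolding B_def by blast
qed

text \<open>
  In the coordinates given by an orthonormal eigenbasis of \<open>transpose_mat M * M\<close>, both the Euclidean
  norm and the norm of the image under \<open>M\<close> are diagonal quadratic forms. All later statements about
  singular values are read off from these two formulas.
\<close>
lemma singular_coordinates:
  assumes M: "M \<in> carrier_mat m n"
  obtains Q es where "Q \<in> carrier_mat n n" "transpose_mat Q * Q = 1\<^sub>m n"
    "sing_vals M = map sqrt es" "length es = n"
    "\<And>i. i < n \<Longrightarrow> 0 \<le> es ! i" "\<And>i j. i \<le> j \<Longrightarrow> j < n \<Longrightarrow> es ! j \<le> es ! i"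
    "\<And>y. y \<in> carrier_vec n \<Longrightarrow> (vnorm (Q *\<^sub>v y))\<^sup>2 = (\<Sum>i<n. (y $ i)\<^sup>2)"
    "\<And>y. y \<in> carrier_vec n \<Longrightarrow> (vnorm (M *\<^sub>v (Q *\<^sub>v y)))\<^sup>2 = (\<Sum>i<n. es ! i * (y $ i)\<^sup>2)"
proof -
  obtain Q es where Q: "Q \<in> carrier_mat n n" "transpose_mat Q * Q = 1\<^sub>m n"
    and MQ: "transpose_mat M * M * Q = Q * mat n n (\<lambda>(i, j). if i = j then es ! i else 0)"
    and es: "sing_vals M = map sqrt es" "length es = n" "sorted (rev es)"
    using sing_vals_eigenbasis[OF M] .
  define D where "D = mat n n (\<lambda>(i, j). if i = j then es ! i else 0)"
  have D: "D \<in> carrier_mat n n"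
    by (simp add: D_def)
  have isom: "(Q *\<^sub>v y) \<bullet> (Q *\<^sub>v z) = y \<bullet> z" if yz: "y \<in> carrier_vec n" "z \<in> carrier_vec n" for y z
  proof -
    have "(Q *\<^sub>v y) \<bullet> (Q *\<^sub>v z) = y \<bullet> (transpose_mat Q *\<^sub>v (Q *\<^sub>v z))"
      using transpose_vec_mult_scalar[OF Q(1) yz(1), of "Q *\<^sub>v z"] Q(1) yz
      by (simp add: comm_scalar_prod[of _ n])
    also have "transpose_mat Q *\<^sub>v (Q *\<^sub>v z) = z"
      using assoc_mult_mat_vec[of "transpose_mat Q" n n Q n z] Q yz by simp
    finally show ?thesis .
  qed
  have 1: "(vnorm (Q *\<^sub>v y))\<^sup>2 = (\<Sum>i<n. (y $ i)\<^sup>2)" if "y \<in> carrier_vec n" for y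
    using isom[OF that that] that by (simp add: vnorm_power2 scalar_prod_self)
  have 2: "(vnorm (M *\<^sub>v (Q *\<^sub>v y)))\<^sup>2 = (\<Sum>i<n. es ! i * (y $ i)\<^sup>2)" if y: "y \<in> carrier_vec n" for y
  proof -
    have Qy: "Q *\<^sub>v y \<in> carrier_vec n" and MQy: "M *\<^sub>v (Q *\<^sub>v y) \<in> carrier_vec m"
      using Q M y by auto
    have Dy: "D *\<^sub>v y = vec n (\<lambda>i. es ! i * y $ i)"
    proof (rule eq_vecI)
      fix i assume "i < dim_vec (vec n (\<lambda>i. es ! i * y $ i))"
      moreover from this have "(\<Sum>j<n. (if i = j then es ! i else 0) * y $ j) = es ! i * y $ i"
        by (subst sum.remove[of _ i]) auto
      ultimately show "(D *\<^sub>v y) $ i = vec n (\<lambda>i. es ! i * y $ i) $ i"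
        using y by (simp add: D_def scalar_prod_def atLeast0LessThan)
    qed (simp add: D_def)
    have "(vnorm (M *\<^sub>v (Q *\<^sub>v y)))\<^sup>2 = (Q *\<^sub>v y) \<bullet> (transpose_mat M *\<^sub>v (M *\<^sub>v (Q *\<^sub>v y)))"
      unfolding vnorm_power2
      using transpose_vec_mult_scalar[OF M Qy MQy] M Qy MQy
      by (simp add: comm_scalar_prod[of _ n])
    also have "transpose_mat M *\<^sub>v (M *\<^sub>v (Q *\<^sub>v y)) = transpose_mat M * M * Q *\<^sub>v y"
      using M Q y by (simp add: assoc_mult_mat_vec[of _ n m _ n] assoc_mult_mat_vec[of _ n n Q n])
    also have "\<dots> = Q *\<^sub>v (D *\<^sub>v y)"
      unfolding MQ D_def[symmetric] using Q D y by (simp add: assoc_mult_mat_vec[of _ n n _ n])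
    also have "(Q *\<^sub>v y) \<bullet> (Q *\<^sub>v (D *\<^sub>v y)) = y \<bullet> (D *\<^sub>v y)"
      using y D by (intro isom) auto
    also have "\<dots> = (\<Sum>i<n. es ! i * (y $ i)\<^sup>2)"
      unfolding Dy using y
      by (simp add: scalar_prod_def atLeast0LessThan power2_eq_square mult_ac)
    finally show ?thesis .
  qed
  have 3: "0 \<le> es ! i" if i: "i < n" for i
  proof -
    have "(\<Sum>j<n. es ! j * (unit_vec n i $ j)\<^sup>2) = es ! i"
      using i by (subst sum.remove[of _ i]) auto
    then show ?thesis
      using 2[of "unit_vec n i"] by (metis unit_vec_carrier zero_le_power2)
  qed
  have 4: "es ! j \<le> es ! i" if "i \<le> j" "j < n" for i j
    using sorted_rev_nth_mono[OF es(3) that(1)] that(2) es(2) by simp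
  show ?thesis
    using that[OF Q es(1,2) 3 4 1 2] .
qed

lemma sing_val_eq_nth:
  assumes "M \<in> carrier_mat m n" "1 \<le> j" "j \<le> min m n" "sing_vals M = map sqrt es" "length es = n"
  shows "sing_val M j = sqrt (es ! (j - 1))"
proof -
  have "j - 1 < length es"
    using assms by auto
  then show ?thesis
    using assms by (simp add: sing_val_def)
qed

lemma sing_val_nonneg:
  assumes "M \<in> carrier_mat m n"
  shows "0 \<le> sing_val M j"
proof (rule singular_coordinates[OF assms])
  fix Q es
  assume "sing_vals M = map sqrt es" "length es = n" "\<And>i. i < n \<Longrightarrow> 0 \<le> es ! i"
  then show ?thesis
    using assms by (auto simp: sing_val_def)
qed

text \<open>
  The upper half of the min-max principle: \<open>j - 1\<close> linear constraints, namely orthogonality to the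
  leading \<open>j - 1\<close> right singular vectors, force amplification by at most the \<open>j\<close>-th singular value.
\<close>
lemma sing_val_constraints:
  assumes M: "M \<in> carrier_mat m n" and j: "1 \<le> j" "j \<le> min m n"
  obtains F where "F \<in> carrier_mat (j - 1) n"
    "\<And>x. x \<in> carrier_vec n \<Longrightarrow> F *\<^sub>v x = 0\<^sub>v (j - 1) \<Longrightarrow>
      vnorm (M *\<^sub>v x) \<le> sing_val M j * vnorm x"
proof -
  obtain Q es where Q: "Q \<in> carrier_mat n n" "transpose_mat Q * Q = 1\<^sub>m n"
    and es: "sing_vals M = map sqrt es" "length es = n" "\<And>i. i < n \<Longrightarrow> 0 \<le> es ! i"
      "\<And>i j. i \<le> j \<Longrightarrow> j < n \<Longrightarrow> es ! j \<le> es ! i"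
    and n1: "\<And>y. y \<in> carrier_vec n \<Longrightarrow> (vnorm (Q *\<^sub>v y))\<^sup>2 = (\<Sum>i<n. (y $ i)\<^sup>2)"
    and n2: "\<And>y. y \<in> carrier_vec n \<Longrightarrow>
      (vnorm (M *\<^sub>v (Q *\<^sub>v y)))\<^sup>2 = (\<Sum>i<n. es ! i * (y $ i)\<^sup>2)"
    using singular_coordinates[OF M] by blast
  have j1: "j - 1 < n"
    using j by auto
  define F where "F = mat (j - 1) n (\<lambda>(i, l). Q $$ (l, i))"
  have QT: "transpose_mat Q \<in> carrier_mat n n"
    using Q by simp
  have QQT: "Q * transpose_mat Q = 1\<^sub>m n"
    using mat_mult_left_right_inverse[OF QT Q(1) Q(2)] .
  show ?thesis
  proof (rule that)
    show "F \<in> carrier_mat (j - 1) n"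
      by (simp add: F_def)
    fix x assume x: "x \<in> carrier_vec n" and Fx: "F *\<^sub>v x = 0\<^sub>v (j - 1)"
    define y where "y = transpose_mat Q *\<^sub>v x"
    have y: "y \<in> carrier_vec n"
      using QT x unfolding y_def by (rule mult_mat_vec_carrier)
    have xy: "Q *\<^sub>v y = x"
      using assoc_mult_mat_vec[OF Q(1) QT x] x unfolding y_def QQT by simp
    have y0: "y $ i = 0" if "i < j - 1" for i
    proof -
      have "row F i = row (transpose_mat Q) i"
        using that j Q by (intro eq_vecI) (auto simp: F_def)
      moreover have "row F i \<bullet> x = 0"
        using arg_cong[OF Fx, of "\<lambda>v. v $ i"] that by (simp add: F_def)
      moreover have "i < n"
        using that j by linarith
      ultimately show ?thesis
        using Q by (simp add: y_def)
    qed
    have "(vnorm (M *\<^sub>v x))\<^sup>2 = (\<Sum>i<n. es ! i * (y $ i)\<^sup>2)"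
      using n2[OF y] xy by simp
    also have "\<dots> \<le> (\<Sum>i<n. es ! (j - 1) * (y $ i)\<^sup>2)"
    proof (rule sum_mono)
      fix i assume "i \<in> {..<n}"
      then show "es ! i * (y $ i)\<^sup>2 \<le> es ! (j - 1) * (y $ i)\<^sup>2"
        using y0[of i] es(4)[of "j - 1" i] by (cases "i < j - 1") (auto intro: mult_right_mono)
    qed
    also have "\<dots> = (sing_val M j * vnorm x)\<^sup>2"
      using n1[OF y] es(3)[OF j1]
      by (simp add: sing_val_eq_nth[OF M j es(1,2)] xy power_mult_distrib sum_distrib_left)
    finally show "vnorm (M *\<^sub>v x) \<le> sing_val M j * vnorm x"
      by (rule power2_le_imp_le) (simp add: sing_val_nonneg[OF M])
  qed
qed

text \<open>
  The lower half of the min-max principle: on the span of the leading \<open>j\<close> right singular vectors,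
  given as the range of an injective matrix \<open>V\<close>, the amplification is at least the \<open>j\<close>-th singular
  value.
\<close>
lemma sing_val_test_space:
  assumes M: "M \<in> carrier_mat m n" and j: "1 \<le> j" "j \<le> min m n"
  obtains V where "V \<in> carrier_mat n j"
    "\<And>c. c \<in> carrier_vec j \<Longrightarrow> V *\<^sub>v c = 0\<^sub>v n \<Longrightarrow> c = 0\<^sub>v j"
    "\<And>c. c \<in> carrier_vec j \<Longrightarrow> sing_val M j * vnorm (V *\<^sub>v c) \<le> vnorm (M *\<^sub>v (V *\<^sub>v c))"
proof -
  obtain Q es where Q: "Q \<in> carrier_mat n n" "transpose_mat Q * Q = 1\<^sub>m n"
    and es: "sing_vals M = map sqrt es" "length es = n" "\<And>i. i < n \<Longrightarrow> 0 \<le> es ! i"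
      "\<And>i j. i \<le> j \<Longrightarrow> j < n \<Longrightarrow> es ! j \<le> es ! i"
    and n1: "\<And>y. y \<in> carrier_vec n \<Longrightarrow> (vnorm (Q *\<^sub>v y))\<^sup>2 = (\<Sum>i<n. (y $ i)\<^sup>2)"
    and n2: "\<And>y. y \<in> carrier_vec n \<Longrightarrow>
      (vnorm (M *\<^sub>v (Q *\<^sub>v y)))\<^sup>2 = (\<Sum>i<n. es ! i * (y $ i)\<^sup>2)"
    using singular_coordinates[OF M] by blast
  have j1: "j - 1 < n"
    using j by auto
  define V where "V = mat n j (\<lambda>(i, l). Q $$ (i, l))"
  have V: "V \<in> carrier_mat n j"
    by (simp add: V_def)
  define pad :: "real vec \<Rightarrow> real vec" where "pad c = vec n (\<lambda>i. if i < j then c $ i else 0)" for c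
  have pad: "pad c \<in> carrier_vec n" for c
    by (simp add: pad_def)
  have VQ: "V *\<^sub>v c = Q *\<^sub>v pad c" if c: "c \<in> carrier_vec j" for c
  proof (rule eq_vecI)
    fix i assume "i < dim_vec (Q *\<^sub>v pad c)"
    then have i: "i < n"
      using Q by simp
    have "(\<Sum>l<n. Q $$ (i, l) * (if l < j then c $ l else 0)) = (\<Sum>l<j. Q $$ (i, l) * c $ l)"
      using j by (intro sum.mono_neutral_cong_right) auto
    then show "(V *\<^sub>v c) $ i = (Q *\<^sub>v pad c) $ i"
      using i c Q j by (simp add: V_def pad_def scalar_prod_def atLeast0LessThan)
  qed (use Q in \<open>simp add: V_def\<close>)
  have nV: "(vnorm (V *\<^sub>v c))\<^sup>2 = (\<Sum>i<n. (pad c $ i)\<^sup>2)" if "c \<in> carrier_vec j" for c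
    using n1[OF pad] VQ[OF that] by simp
  show ?thesis
  proof (rule that[OF V])
    fix c :: "real vec" assume c: "c \<in> carrier_vec j"
    {
      assume "V *\<^sub>v c = 0\<^sub>v n"
      then have "(\<Sum>i<n. (pad c $ i)\<^sup>2) = 0"
        using nV[OF c] vnorm_eq_0_iff[of "V *\<^sub>v c" n] by simp
      then have "pad c $ i = 0" if "i < n" for i
        using that by (simp add: sum_nonneg_eq_0_iff)
      then have "c $ i = 0" if "i < j" for i
        using that j by (auto simp: pad_def dest!: meta_spec[of _ i])
      then show "c = 0\<^sub>v j"
        using c by (intro eq_vecI) auto
    }
    have "(sing_val M j * vnorm (V *\<^sub>v c))\<^sup>2 = (\<Sum>i<n. es ! (j - 1) * (pad c $ i)\<^sup>2)"
      using es(3)[OF j1]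
      by (simp add: sing_val_eq_nth[OF M j es(1,2)] nV[OF c] power_mult_distrib sum_distrib_left)
    also have "\<dots> \<le> (\<Sum>i<n. es ! i * (pad c $ i)\<^sup>2)"
    proof (rule sum_mono)
      fix i assume "i \<in> {..<n}"
      then show "es ! (j - 1) * (pad c $ i)\<^sup>2 \<le> es ! i * (pad c $ i)\<^sup>2"
        using es(4)[of i "j - 1"] j by (cases "i < j") (auto simp: pad_def intro: mult_right_mono)
    qed
    also have "\<dots> = (vnorm (M *\<^sub>v (V *\<^sub>v c)))\<^sup>2"
      using n2[OF pad] VQ[OF c] by simp
    finally show "sing_val M j * vnorm (V *\<^sub>v c) \<le> vnorm (M *\<^sub>v (V *\<^sub>v c))"
      by (rule power2_le_imp_le) simp
  qed
qed

text \<open>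
  Fewer than \<open>j\<close> linear constraints leave a nonzero vector in the \<open>j\<close>-dimensional test space of
  \<open>M\<close>; comparing both bounds at that vector gives the claim. Upper bounds for singular values are
  obtained below by exhibiting such constraints.
\<close>
lemma sing_val_le:
  assumes M: "M \<in> carrier_mat m n" and j: "1 \<le> j" "j \<le> min m n"
    and F: "F \<in> carrier_mat r n" and r: "r < j"
    and bound: "\<And>x. x \<in> carrier_vec n \<Longrightarrow> F *\<^sub>v x = 0\<^sub>v r \<Longrightarrow> vnorm (M *\<^sub>v x) \<le> s * vnorm x"
  shows "sing_val M j \<le> s"
proof -
  obtain V where V: "V \<in> carrier_mat n j"
    and inj: "\<And>c. c \<in> carrier_vec j \<Longrightarrow> V *\<^sub>v c = 0\<^sub>v n \<Longrightarrow> c = 0\<^sub>v j"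
    and low: "\<And>c. c \<in> carrier_vec j \<Longrightarrow>
      sing_val M j * vnorm (V *\<^sub>v c) \<le> vnorm (M *\<^sub>v (V *\<^sub>v c))"
    using sing_val_test_space[OF M j] by blast
  have FV: "F * V \<in> carrier_mat r j"
    using F V by simp
  obtain c where c: "c \<in> carrier_vec j" "c \<noteq> 0\<^sub>v j" "(F * V) *\<^sub>v c = 0\<^sub>v r"
    using wide_mat_kernel[OF FV r] .
  have Vc: "V *\<^sub>v c \<in> carrier_vec n"
    using V c(1) by (rule mult_mat_vec_carrier)
  have "F *\<^sub>v (V *\<^sub>v c) = 0\<^sub>v r"
    using c(3) assoc_mult_mat_vec[OF F V c(1)] by simp
  then have "sing_val M j * vnorm (V *\<^sub>v c) \<le> s * vnorm (V *\<^sub>v c)"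
    using low[OF c(1)] bound[OF Vc] by linarith
  moreover have "vnorm (V *\<^sub>v c) > 0"
    using inj[OF c(1)] c(2) vnorm_pos[OF Vc] by blast
  ultimately show ?thesis
    by simp
qed

text \<open>
  Dually, every \<open>j\<close>-dimensional test space contains a nonzero vector satisfying the \<open>j - 1\<close>
  constraints that belong to \<open>M\<close>.
\<close>
lemma sing_val_ge:
  assumes M: "M \<in> carrier_mat m n" and j: "1 \<le> j" "j \<le> min m n"
    and V: "V \<in> carrier_mat n j"
    and inj: "\<And>c. c \<in> carrier_vec j \<Longrightarrow> V *\<^sub>v c = 0\<^sub>v n \<Longrightarrow> c = 0\<^sub>v j"
    and bound: "\<And>c. c \<in> carrier_vec j \<Longrightarrow> s * vnorm (V *\<^sub>v c) \<le> vnorm (M *\<^sub>v (V *\<^sub>v c))"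
  shows "s \<le> sing_val M j"
proof -
  obtain F where F: "F \<in> carrier_mat (j - 1) n"
    and up: "\<And>x. x \<in> carrier_vec n \<Longrightarrow> F *\<^sub>v x = 0\<^sub>v (j - 1) \<Longrightarrow>
      vnorm (M *\<^sub>v x) \<le> sing_val M j * vnorm x"
    using sing_val_constraints[OF M j] by blast
  have FV: "F * V \<in> carrier_mat (j - 1) j"
    using F V by simp
  obtain c where c: "c \<in> carrier_vec j" "c \<noteq> 0\<^sub>v j" "(F * V) *\<^sub>v c = 0\<^sub>v (j - 1)"
    using wide_mat_kernel[OF FV] j by auto
  have Vc: "V *\<^sub>v c \<in> carrier_vec n"
    using V c(1) by (rule mult_mat_vec_carrier)
  have "F *\<^sub>v (V *\<^sub>v c) = 0\<^sub>v (j - 1)"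
    using c(3) assoc_mult_mat_vec[OF F V c(1)] by simp
  then have "s * vnorm (V *\<^sub>v c) \<le> sing_val M j * vnorm (V *\<^sub>v c)"
    using bound[OF c(1)] up[OF Vc] by linarith
  moreover have "vnorm (V *\<^sub>v c) > 0"
    using inj[OF c(1)] c(2) vnorm_pos[OF Vc] by blast
  ultimately show ?thesis
    by simp
qed

lemma sing_val_antimono:
  assumes M: "M \<in> carrier_mat m n" and ij: "1 \<le> i" "i \<le> j" "j \<le> min m n"
  shows "sing_val M j \<le> sing_val M i"
proof -
  have i: "i \<le> min m n" and j: "1 \<le> j" and lt: "i - 1 < j"
    using ij by auto
  obtain F where F: "F \<in> carrier_mat (i - 1) n"
    "\<And>x. x \<in> carrier_vec n \<Longrightarrow> F *\<^sub>v x = 0\<^sub>v (i - 1) \<Longrightarrow>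
      vnorm (M *\<^sub>v x) \<le> sing_val M i * vnorm x"
    using sing_val_constraints[OF M ij(1) i] by blast
  show ?thesis
    by (rule sing_val_le[OF M j ij(3) F(1) lt F(2)])
qed

text \<open>
  Orthogonal factors turn \<open>transpose_mat M * M\<close> into a similar matrix, which has the same
  characteristic polynomial.
\<close>
lemma sing_val_orthogonal_invariant:
  assumes M: "M \<in> carrier_mat m n"
    and P: "P \<in> carrier_mat m m" "transpose_mat P * P = 1\<^sub>m m"
    and R: "R \<in> carrier_mat n n" "transpose_mat R * R = 1\<^sub>m n"
  shows "sing_val (P * M * R) j = sing_val M j"
proof -
  have RT: "transpose_mat R \<in> carrier_mat n n" and PT: "transpose_mat P \<in> carrier_mat m m"
    and MT: "transpose_mat M \<in> carrier_mat n m"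
    using R P M by auto
  have RRT: "R * transpose_mat R = 1\<^sub>m n"
    using mat_mult_left_right_inverse[OF RT R(1) R(2)] .
  have PM: "P * M \<in> carrier_mat m n" and PMR: "P * M * R \<in> carrier_mat m n"
    using P M R by auto
  have B: "transpose_mat M * M \<in> carrier_mat n n"
    using M by simp
  have "transpose_mat (P * M) * (P * M) = transpose_mat M * (transpose_mat P * (P * M))"
    unfolding transpose_mult[OF P(1) M] by (rule assoc_mult_mat[OF MT PT PM])
  also have "transpose_mat P * (P * M) = M"
    using assoc_mult_mat[OF PT P(1) M] unfolding P(2) left_mult_one_mat[OF M] by simp
  finally have PMPM: "transpose_mat (P * M) * (P * M) = transpose_mat M * M" .
  have PMT: "transpose_mat (P * M) \<in> carrier_mat n m"
    using PM by simp
  have "transpose_mat (P * M * R) * (P * M * R) =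
      transpose_mat R * (transpose_mat (P * M) * (P * M * R))"
    unfolding transpose_mult[OF PM R(1)] by (rule assoc_mult_mat[OF RT PMT PMR])
  also have "transpose_mat (P * M) * (P * M * R) = transpose_mat M * M * R"
    using assoc_mult_mat[OF PMT PM R(1)] PMPM by simp
  also have "transpose_mat R * (transpose_mat M * M * R) = transpose_mat R * (transpose_mat M * M) * R"
    using assoc_mult_mat[OF RT B R(1)] by simp
  finally have "similar_mat_wit (transpose_mat (P * M * R) * (P * M * R)) (transpose_mat M * M)
      (transpose_mat R) R"
    by (intro similar_mat_witI[OF R(2) RRT]) (use B RT R PMR in auto)
  then have "char_poly (transpose_mat (P * M * R) * (P * M * R)) = char_poly (transpose_mat M * M)"
    by (intro char_poly_similar) (auto simp: similar_mat_def)
  then show ?thesis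
    using PMR M unfolding sing_val_def sing_vals_def by auto
qed

text \<open>
  The product of the eigenvalues of \<open>transpose_mat M * M\<close> is its determinant, the square of \<open>det M\<close>.
\<close>
lemma vol_eq_abs_det:
  assumes M: "M \<in> carrier_mat k k"
  shows "vol M = \<bar>det M\<bar>"
proof -
  obtain Q es where Q: "Q \<in> carrier_mat k k" "transpose_mat Q * Q = 1\<^sub>m k"
    and MQ: "transpose_mat M * M * Q = Q * mat k k (\<lambda>(i, j). if i = j then es ! i else 0)"
    and es: "sing_vals M = map sqrt es" "length es = k"
    using sing_vals_eigenbasis[OF M] .
  define D where "D = mat k k (\<lambda>(i, j). if i = j then es ! i else 0)"
  have D: "D \<in> carrier_mat k k"
    by (simp add: D_def)
  have MT: "transpose_mat M \<in> carrier_mat k k" and QT: "transpose_mat Q \<in> carrier_mat k k"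
    using M Q by auto
  have "det Q \<noteq> 0"
    using det_mult[OF QT Q(1)] Q(2) by auto
  moreover have "det (transpose_mat M * M * Q) = det (Q * D)"
    using MQ by (simp add: D_def)
  then have "det M * det M * det Q = det Q * det D"
    using M MT Q D by (simp add: det_mult[of _ k] det_transpose)
  ultimately have dd: "det M * det M = det D"
    by simp
  have "det D = prod_list (diag_mat D)"
    by (rule det_upper_triangular[OF _ D]) (auto simp: D_def)
  also have "\<dots> = (\<Prod>i<k. es ! i)"
    by (simp add: prod_list_diag_prod D_def atLeast0LessThan)
  finally have "sqrt (det M * det M) = sqrt (\<Prod>i<k. es ! i)"
    unfolding dd by simp
  also have "\<dots> = (\<Prod>i<k. sqrt (es ! i))"
    by (induction k) (simp_all add: real_sqrt_mult)
  also have "\<dots> = (\<Prod>j = 1..k. sing_val M j)"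
    using sing_val_eq_nth[OF M _ _ es]
    by (intro prod.reindex_bij_witness[of _ "\<lambda>j. j - 1" Suc]) auto
  finally show ?thesis
    using M by (simp add: vol_def)
qed

section \<open>Singular value bounds for block elimination\<close>

lemma vec_split:
  fixes z :: "real vec"
  assumes "z \<in> carrier_vec (l + r)"
  obtains u w where "u \<in> carrier_vec l" "w \<in> carrier_vec r" "z = u @\<^sub>v w"
  using vec_first_last_append[OF assms] vec_first_carrier vec_last_carrier by metis

lemma minus_add_cancel_vec: "v \<in> carrier_vec r \<Longrightarrow> w \<in> carrier_vec r \<Longrightarrow> v - w + w = v"
  for v w :: "real vec"
  by (intro eq_vecI) auto

lemma add_minus_cancel_vec: "v \<in> carrier_vec r \<Longrightarrow> w \<in> carrier_vec r \<Longrightarrow> v + w - v = w"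
  for v w :: "real vec"
  by (intro eq_vecI) auto

text \<open>
  The analytic half of the argument needs only operator norm bounds: \<open>a\<close> for \<open>A21 * G\<close>, \<open>b\<close> for
  \<open>G * A12\<close>, \<open>s\<close> for the Schur complement, and \<open>g\<close> for the inverse \<open>G\<close> of the pivot block.
\<close>
locale block_elimination =
  fixes k h l :: nat and A11 A12 A21 A22 G :: "real mat" and a b s g :: real
  assumes A11: "A11 \<in> carrier_mat k k" and A12: "A12 \<in> carrier_mat k l"
    and A21: "A21 \<in> carrier_mat h k" and A22: "A22 \<in> carrier_mat h l"
    and G: "G \<in> carrier_mat k k" "A11 * G = 1\<^sub>m k" "G * A11 = 1\<^sub>m k"
    and k_pos: "1 \<le> k"
    and nonneg: "0 \<le> a" "0 \<le> b" "0 \<le> s" "0 \<le> g"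
    and Y_bound: "\<And>x. x \<in> carrier_vec k \<Longrightarrow> vnorm ((A21 * G) *\<^sub>v x) \<le> a * vnorm x"
    and X_bound: "\<And>w. w \<in> carrier_vec l \<Longrightarrow> vnorm ((G * A12) *\<^sub>v w) \<le> b * vnorm w"
    and S_bound: "\<And>w. w \<in> carrier_vec l \<Longrightarrow>
      vnorm ((A22 - A21 * G * A12) *\<^sub>v w) \<le> s * vnorm w"
    and G_bound: "\<And>x. x \<in> carrier_vec k \<Longrightarrow> vnorm (G *\<^sub>v x) \<le> g * vnorm x"
begin

definition "X = G * A12"
definition "Y = A21 * G"
definition "S = A22 - A21 * G * A12"
definition "B = four_block_mat A11 A12 A21 A22"
definition "C = four_block_mat A11 A12 A21 (A21 * G * A12)"
definition "E = four_block_mat (0\<^sub>m k k) (0\<^sub>m k l) (0\<^sub>m h k) S"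

lemma carriers:
  "X \<in> carrier_mat k l" "Y \<in> carrier_mat h k" "S \<in> carrier_mat h l"
  "B \<in> carrier_mat (k + h) (k + l)" "C \<in> carrier_mat (k + h) (k + l)"
  "E \<in> carrier_mat (k + h) (k + l)" "A21 * G * A12 \<in> carrier_mat h l"
proof -
  show X: "X \<in> carrier_mat k l" and "Y \<in> carrier_mat h k" and S: "S \<in> carrier_mat h l"
    and U: "A21 * G * A12 \<in> carrier_mat h l"
    using A12 A21 A22 G by (auto simp: X_def Y_def S_def)
  show "B \<in> carrier_mat (k + h) (k + l)" "C \<in> carrier_mat (k + h) (k + l)"
    "E \<in> carrier_mat (k + h) (k + l)"
    unfolding B_def C_def E_def
    using four_block_carrier_mat[OF A11 A22] four_block_carrier_mat[OF A11 U]
      four_block_carrier_mat[OF zero_carrier_mat S] by auto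
qed

lemma A11_mult_X: "A11 * X = A12"
  unfolding X_def using assoc_mult_mat[OF A11 G(1) A12] G(2) A12 by simp

lemma Y_mult_A11: "Y * A11 = A21"
  unfolding Y_def using assoc_mult_mat[OF A21 G(1) A11] G(3) A21 by simp

lemma A21_mult_X: "A21 * X = A21 * G * A12"
  unfolding X_def using assoc_mult_mat[OF A21 G(1) A12] by simp

lemma G_A11_vec: "x \<in> carrier_vec k \<Longrightarrow> G *\<^sub>v (A11 *\<^sub>v x) = x"
  using assoc_mult_mat_vec[OF G(1) A11] G(3) by simp

lemma A11_X_vec: "w \<in> carrier_vec l \<Longrightarrow> A11 *\<^sub>v (X *\<^sub>v w) = A12 *\<^sub>v w"
  using assoc_mult_mat_vec[OF A11 carriers(1)] A11_mult_X by simp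

lemma Y_A11_vec: "x \<in> carrier_vec k \<Longrightarrow> Y *\<^sub>v (A11 *\<^sub>v x) = A21 *\<^sub>v x"
  using assoc_mult_mat_vec[OF carriers(2) A11] Y_mult_A11 by simp

lemma A21_X_vec: "w \<in> carrier_vec l \<Longrightarrow> A21 *\<^sub>v (X *\<^sub>v w) = (A21 * G * A12) *\<^sub>v w"
  using assoc_mult_mat_vec[OF A21 carriers(1)] A21_mult_X by simp

text \<open>
  The substitution \<open>x = u + X w\<close> is block elimination of the columns; it decouples the pivot block
  from the Schur complement.
\<close>
lemma C_mult_vec:
  assumes u: "u \<in> carrier_vec k" and w: "w \<in> carrier_vec l"
  defines "x \<equiv> u + X *\<^sub>v w"
  shows "C *\<^sub>v (u @\<^sub>v w) = (A11 *\<^sub>v x) @\<^sub>v (Y *\<^sub>v (A11 *\<^sub>v x))"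
proof -
  have Xw: "X *\<^sub>v w \<in> carrier_vec k"
    using carriers(1) w by (rule mult_mat_vec_carrier)
  have x: "x \<in> carrier_vec k"
    using u Xw by (simp add: x_def)
  have 1: "A11 *\<^sub>v x = A11 *\<^sub>v u + A12 *\<^sub>v w"
    unfolding x_def mult_add_distrib_mat_vec[OF A11 u Xw] A11_X_vec[OF w] ..
  have 2: "Y *\<^sub>v (A11 *\<^sub>v x) = A21 *\<^sub>v u + (A21 * G * A12) *\<^sub>v w"
    unfolding Y_A11_vec[OF x] unfolding x_def mult_add_distrib_mat_vec[OF A21 u Xw] A21_X_vec[OF w] ..
  show ?thesis
    unfolding 1[symmetric] 2 C_def four_block_mat_mult_vec[OF A11 A12 A21 carriers(7) u w]
    unfolding 1 ..
qed

lemma E_mult_vec: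
  assumes u: "u \<in> carrier_vec k" and w: "w \<in> carrier_vec l"
  shows "E *\<^sub>v (u @\<^sub>v w) = 0\<^sub>v k @\<^sub>v (S *\<^sub>v w)"
proof -
  have "S *\<^sub>v w \<in> carrier_vec h"
    using carriers(3) w by (rule mult_mat_vec_carrier)
  moreover have "0\<^sub>m r c *\<^sub>v v = 0\<^sub>v r" if "v \<in> carrier_vec c" for r c and v :: "real vec"
    using that by (intro eq_vecI) auto
  ultimately show ?thesis
    using u w unfolding E_def
    by (simp add: four_block_mat_mult_vec[OF zero_carrier_mat zero_carrier_mat zero_carrier_mat carriers(3) u w])
qed

lemma B_eq: "B = C + E" and B_minus_C: "B - C = E"
proof -
  show "B = C + E"
    unfolding B_def C_def E_def S_def using A11 A12 A21 A22 G
    by (intro eq_matI) auto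
  show "B - C = E"
    unfolding B_def C_def E_def S_def using A11 A12 A21 A22 G
    by (intro eq_matI) auto
qed

lemma B_mult_vec:
  assumes u: "u \<in> carrier_vec k" and w: "w \<in> carrier_vec l"
  defines "x \<equiv> u + X *\<^sub>v w"
  shows "B *\<^sub>v (u @\<^sub>v w) = (A11 *\<^sub>v x) @\<^sub>v (Y *\<^sub>v (A11 *\<^sub>v x) + S *\<^sub>v w)"
proof -
  have z: "u @\<^sub>v w \<in> carrier_vec (k + l)"
    using u w by simp
  have "X *\<^sub>v w \<in> carrier_vec k"
    using carriers(1) w by (rule mult_mat_vec_carrier)
  then have x: "x \<in> carrier_vec k"
    using u by (simp add: x_def)
  have Ax: "A11 *\<^sub>v x \<in> carrier_vec k"
    using A11 x by (rule mult_mat_vec_carrier)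
  have YAx: "Y *\<^sub>v (A11 *\<^sub>v x) \<in> carrier_vec h"
    using carriers(2) Ax by (rule mult_mat_vec_carrier)
  have Sw: "S *\<^sub>v w \<in> carrier_vec h"
    using carriers(3) w by (rule mult_mat_vec_carrier)
  have "B *\<^sub>v (u @\<^sub>v w) = C *\<^sub>v (u @\<^sub>v w) + E *\<^sub>v (u @\<^sub>v w)"
    unfolding B_eq by (rule add_mult_distrib_mat_vec[OF carriers(5,6) z])
  also have "\<dots> = ((A11 *\<^sub>v x) @\<^sub>v (Y *\<^sub>v (A11 *\<^sub>v x))) + (0\<^sub>v k @\<^sub>v (S *\<^sub>v w))"
    unfolding C_mult_vec[OF u w] E_mult_vec[OF u w] x_def ..
  also have "\<dots> = (A11 *\<^sub>v x + 0\<^sub>v k) @\<^sub>v (Y *\<^sub>v (A11 *\<^sub>v x) + S *\<^sub>v w)"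
    by (rule append_vec_add[OF Ax zero_carrier_vec YAx Sw])
  finally show ?thesis
    using Ax by simp
qed

lemma vnorm_le_A11: "x \<in> carrier_vec k \<Longrightarrow> vnorm x \<le> g * vnorm (A11 *\<^sub>v x)"
  using G_bound[of "A11 *\<^sub>v x"] G_A11_vec[of x] A11 by simp

lemma g_pos: "0 < g"
proof -
  have "unit_vec k 0 $ 0 \<noteq> (0\<^sub>v k :: real vec) $ 0"
    using k_pos by simp
  then have "unit_vec k 0 \<noteq> (0\<^sub>v k :: real vec)"
    by metis
  then have "0 < vnorm (unit_vec k 0)"
    by (intro vnorm_pos) auto
  also have "\<dots> \<le> g * vnorm (A11 *\<^sub>v unit_vec k 0)"
    by (rule vnorm_le_A11) simp
  finally show ?thesis
    using nonneg(4) by (cases "g = 0") auto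
qed

lemma E_bound: "z \<in> carrier_vec (k + l) \<Longrightarrow> vnorm (E *\<^sub>v z) \<le> s * vnorm z"
proof (erule vec_split)
  fix u w :: "real vec" assume u: "u \<in> carrier_vec k" and w: "w \<in> carrier_vec l" and z: "z = u @\<^sub>v w"
  have "vnorm (E *\<^sub>v z) = vnorm (S *\<^sub>v w)"
    unfolding z E_mult_vec[OF u w] vnorm_append_zero ..
  also have "\<dots> \<le> s * vnorm w"
    using S_bound[OF w] by (simp add: S_def)
  also have "\<dots> \<le> s * vnorm z"
    unfolding z using nonneg(3) vnorm_append_ge(2) by (intro mult_left_mono)
  finally show ?thesis .
qed

text \<open>
  An instance of Weyl's inequality for a perturbation of rank at most \<open>k\<close>: to the \<open>j - 1\<close>
  constraints of \<open>E\<close> add the \<open>k\<close> constraints \<open>A11 u + A12 w = 0\<close>, which describe the kernel of \<open>C\<close>.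
  Where all of them hold, \<open>B\<close> and \<open>E\<close> agree.
\<close>
lemma sing_val_B_le_E:
  assumes j: "1 \<le> j" "j \<le> min h l"
  shows "sing_val B (k + j) \<le> sing_val E j"
proof -
  have j': "j \<le> min (k + h) (k + l)" "1 \<le> k + j" "k + j \<le> min (k + h) (k + l)"
    using j by auto
  obtain F where F: "F \<in> carrier_mat (j - 1) (k + l)"
    and FE: "\<And>x. x \<in> carrier_vec (k + l) \<Longrightarrow> F *\<^sub>v x = 0\<^sub>v (j - 1) \<Longrightarrow>
      vnorm (E *\<^sub>v x) \<le> sing_val E j * vnorm x"
    using sing_val_constraints[OF carriers(6) j(1) j'(1)] by blast
  \<comment> \<open>the row \<open>(A11 A12)\<close>, written as a block matrix whose lower blocks have no rows\<close>
  define K where "K = four_block_mat A11 A12 (0\<^sub>m 0 k) (0\<^sub>m 0 l)"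
  have K: "K \<in> carrier_mat (k + 0) (k + l)"
    unfolding K_def by (rule four_block_carrier_mat[OF A11]) simp
  have FK: "F @\<^sub>r K \<in> carrier_mat (j - 1 + (k + 0)) (k + l)"
    using F K by (rule carrier_append_rows)
  show ?thesis
  proof (rule sing_val_le[OF carriers(4) j'(2,3) FK])
    show "j - 1 + (k + 0) < k + j"
      using j by simp
    fix z :: "real vec" assume z: "z \<in> carrier_vec (k + l)"
      and FKz: "(F @\<^sub>r K) *\<^sub>v z = 0\<^sub>v (j - 1 + (k + 0))"
    have Fz: "F *\<^sub>v z \<in> carrier_vec (j - 1)" and Kz: "K *\<^sub>v z \<in> carrier_vec (k + 0)"
      using F K z by (auto simp del: add_0_right intro: mult_mat_vec_carrier)
    have "0\<^sub>v (j - 1 + (k + 0)) = 0\<^sub>v (j - 1) @\<^sub>v (0\<^sub>v (k + 0) :: real vec)"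
      by (intro eq_vecI) auto
    then have "(F *\<^sub>v z) @\<^sub>v (K *\<^sub>v z) = 0\<^sub>v (j - 1) @\<^sub>v 0\<^sub>v (k + 0)"
      using FKz mat_mult_append[OF F K z] by simp
    then have F0: "F *\<^sub>v z = 0\<^sub>v (j - 1)" and K0: "K *\<^sub>v z = 0\<^sub>v (k + 0)"
      using append_vec_eq[OF Fz zero_carrier_vec] by auto
    obtain u w where u: "u \<in> carrier_vec k" and w: "w \<in> carrier_vec l" and zuw: "z = u @\<^sub>v w"
      using vec_split[OF z] by blast
    have Xw: "X *\<^sub>v w \<in> carrier_vec k"
      using carriers(1) w by (rule mult_mat_vec_carrier)
    have "K *\<^sub>v z = (A11 *\<^sub>v u + A12 *\<^sub>v w) @\<^sub>v (0\<^sub>m 0 k *\<^sub>v u + 0\<^sub>m 0 l *\<^sub>v w)"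
      unfolding zuw K_def by (rule four_block_mat_mult_vec[OF A11 A12 _ _ u w]) auto
    then have "(A11 *\<^sub>v u + A12 *\<^sub>v w) @\<^sub>v (0\<^sub>m 0 k *\<^sub>v u + 0\<^sub>m 0 l *\<^sub>v w) = 0\<^sub>v k @\<^sub>v 0\<^sub>v 0"
      using K0 by (auto intro!: eq_vecI)
    then have "A11 *\<^sub>v u + A12 *\<^sub>v w = 0\<^sub>v k"
      using append_vec_eq[of "A11 *\<^sub>v u + A12 *\<^sub>v w" k "0\<^sub>v k"] A11 A12 u w by auto
    then have "A11 *\<^sub>v (u + X *\<^sub>v w) = 0\<^sub>v k"
      unfolding mult_add_distrib_mat_vec[OF A11 u Xw] A11_X_vec[OF w] .
    moreover have "Y *\<^sub>v 0\<^sub>v k = 0\<^sub>v h" "S *\<^sub>v w \<in> carrier_vec h"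
      using carriers(2,3) w by (auto intro!: eq_vecI)
    ultimately have "B *\<^sub>v z = E *\<^sub>v z"
      unfolding zuw B_mult_vec[OF u w] E_mult_vec[OF u w] by simp
    then show "vnorm (B *\<^sub>v z) \<le> sing_val E j * vnorm z"
      using FE[OF z F0] by simp
  qed
qed

text \<open>
  \<open>C\<close> factors as \<open>B * T\<close> with \<open>T (u, w) = (u + X w, 0)\<close>, and \<open>T\<close> has norm at most \<open>1 + b\<close>. Pulling
  the constraints of \<open>B\<close> back along \<open>T\<close> gives constraints for \<open>C\<close>.
\<close>
lemma sing_val_C_le_B:
  assumes j: "1 \<le> j" "j \<le> min (k + h) (k + l)"
  shows "sing_val C j \<le> (1 + b) * sing_val B j"
proof -
  obtain F where F: "F \<in> carrier_mat (j - 1) (k + l)"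
    and FB: "\<And>x. x \<in> carrier_vec (k + l) \<Longrightarrow> F *\<^sub>v x = 0\<^sub>v (j - 1) \<Longrightarrow>
      vnorm (B *\<^sub>v x) \<le> sing_val B j * vnorm x"
    using sing_val_constraints[OF carriers(4) j] by blast
  define T where "T = four_block_mat (1\<^sub>m k) X (0\<^sub>m l k) (0\<^sub>m l l)"
  have T: "T \<in> carrier_mat (k + l) (k + l)"
    unfolding T_def by (rule four_block_carrier_mat) auto
  have FT: "F * T \<in> carrier_mat (j - 1) (k + l)"
    using F T by simp
  show ?thesis
  proof (rule sing_val_le[OF carriers(5) j FT])
    show "j - 1 < j"
      using j by simp
    fix z :: "real vec" assume z: "z \<in> carrier_vec (k + l)" and FTz: "(F * T) *\<^sub>v z = 0\<^sub>v (j - 1)"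
    obtain u w where u: "u \<in> carrier_vec k" and w: "w \<in> carrier_vec l" and zuw: "z = u @\<^sub>v w"
      using vec_split[OF z] by blast
    have Xw: "X *\<^sub>v w \<in> carrier_vec k"
      using carriers(1) w by (rule mult_mat_vec_carrier)
    define x where "x = u + X *\<^sub>v w"
    have x: "x \<in> carrier_vec k"
      using u Xw by (simp add: x_def)
    have z0: "0\<^sub>m l c *\<^sub>v v = 0\<^sub>v l" if "v \<in> carrier_vec c" for c and v :: "real vec"
      using that by (intro eq_vecI) auto
    have Tz: "T *\<^sub>v z = x @\<^sub>v 0\<^sub>v l"
      unfolding zuw T_def x_def
      using four_block_mat_mult_vec[OF one_carrier_mat carriers(1) zero_carrier_mat zero_carrier_mat u w, of l]
        u by (simp add: z0[OF u] z0[OF w])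
    have X0: "X *\<^sub>v 0\<^sub>v l = 0\<^sub>v k" and S0: "S *\<^sub>v 0\<^sub>v l = 0\<^sub>v h"
      using carriers(1,3) by (auto intro!: eq_vecI)
    have Ax: "A11 *\<^sub>v x \<in> carrier_vec k"
      using A11 x by (rule mult_mat_vec_carrier)
    have YAx: "Y *\<^sub>v (A11 *\<^sub>v x) \<in> carrier_vec h"
      using carriers(2) Ax by (rule mult_mat_vec_carrier)
    have CB: "C *\<^sub>v z = B *\<^sub>v (T *\<^sub>v z)"
      unfolding Tz B_mult_vec[OF x zero_carrier_vec] X0 S0
      unfolding zuw C_mult_vec[OF u w] x_def[symmetric] using x YAx by simp
    have "F *\<^sub>v (T *\<^sub>v z) = 0\<^sub>v (j - 1)"
      using FTz assoc_mult_mat_vec[OF F T z] by simp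
    then have "vnorm (C *\<^sub>v z) \<le> sing_val B j * vnorm (T *\<^sub>v z)"
      unfolding CB using FB T z by (meson mult_mat_vec_carrier)
    also have "\<dots> \<le> sing_val B j * ((1 + b) * vnorm z)"
    proof (rule mult_left_mono)
      have "vnorm (T *\<^sub>v z) = vnorm x"
        unfolding Tz by (rule vnorm_append_zero)
      also have "\<dots> \<le> vnorm u + vnorm (X *\<^sub>v w)"
        unfolding x_def by (rule vnorm_triangle[OF u Xw])
      also have "vnorm (X *\<^sub>v w) \<le> b * vnorm w"
        using X_bound[OF w] by (simp add: X_def)
      also have "b * vnorm w \<le> b * vnorm z"
        unfolding zuw using nonneg(2) vnorm_append_ge(2) by (intro mult_left_mono)
      also have "vnorm u \<le> vnorm z"
        unfolding zuw by (rule vnorm_append_ge)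
      finally show "vnorm (T *\<^sub>v z) \<le> (1 + b) * vnorm z"
        by (simp add: algebra_simps)
    qed (rule sing_val_nonneg[OF carriers(4)])
    finally show "vnorm (C *\<^sub>v z) \<le> (1 + b) * sing_val B j * vnorm z"
      by (simp add: mult_ac)
  qed
qed

text \<open>
  \<open>C\<close> contains \<open>A11\<close>, which shrinks no vector by more than the factor \<open>g\<close>; the test space consists
  of the vectors \<open>(c, 0)\<close>.
\<close>
lemma sing_val_C_lower:
  shows "1 \<le> g * sing_val C k"
proof -
  define V where "V = (1\<^sub>m k :: real mat) @\<^sub>r 0\<^sub>m l k"
  have V: "V \<in> carrier_mat (k + l) k"
    unfolding V_def by (rule carrier_append_rows) auto
  have Vc: "V *\<^sub>v c = c @\<^sub>v 0\<^sub>v l" if c: "c \<in> carrier_vec k" for c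
  proof -
    have "0\<^sub>m l k *\<^sub>v c = 0\<^sub>v l"
      using c by (intro eq_vecI) auto
    then show ?thesis
      unfolding V_def using mat_mult_append[OF one_carrier_mat zero_carrier_mat c] c by simp
  qed
  have "1 / g \<le> sing_val C k"
  proof (rule sing_val_ge[OF carriers(5) k_pos _ V])
    show "k \<le> min (k + h) (k + l)"
      by simp
    fix c :: "real vec" assume c: "c \<in> carrier_vec k"
    {
      assume "V *\<^sub>v c = 0\<^sub>v (k + l)"
      then have "vnorm c = 0"
        using vnorm_eq_0_iff[of "V *\<^sub>v c" "k + l"] vnorm_append_zero(1)[of c l] Vc[OF c] by simp
      then show "c = 0\<^sub>v k"
        using vnorm_eq_0_iff[OF c] by simp
    }
    have X0: "X *\<^sub>v 0\<^sub>v l = 0\<^sub>v k"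
      using carriers(1) by (auto intro!: eq_vecI)
    have "vnorm (V *\<^sub>v c) = vnorm c"
      unfolding Vc[OF c] by (rule vnorm_append_zero)
    also have "\<dots> \<le> g * vnorm (A11 *\<^sub>v c)"
      by (rule vnorm_le_A11[OF c])
    also have "vnorm (A11 *\<^sub>v c) \<le> vnorm (C *\<^sub>v (V *\<^sub>v c))"
      unfolding Vc[OF c] C_mult_vec[OF c zero_carrier_vec] X0 using c vnorm_append_ge(1) by simp
    finally show "1 / g * vnorm (V *\<^sub>v c) \<le> vnorm (C *\<^sub>v (V *\<^sub>v c))"
      using g_pos by (simp add: field_simps mult_left_mono)
  qed
  then show ?thesis
    using g_pos by (simp add: field_simps)
qed

text \<open>
  \<open>B = C + E\<close> gives \<open>\<sigma>\<^sub>j(B) \<le> \<sigma>\<^sub>j(C) + s\<close>. The lower bound \<open>1 / g\<close> for the leading \<open>k\<close> singular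
  values of \<open>C\<close> turns the additive error into a relative one.
\<close>
lemma sing_val_B_le_C:
  assumes j: "1 \<le> j" "j \<le> k"
  shows "sing_val B j \<le> (1 + s * g) * sing_val C j"
proof -
  have j': "j \<le> min (k + h) (k + l)" and k': "k \<le> min (k + h) (k + l)"
    using j by auto
  obtain F where F: "F \<in> carrier_mat (j - 1) (k + l)"
    and FC: "\<And>x. x \<in> carrier_vec (k + l) \<Longrightarrow> F *\<^sub>v x = 0\<^sub>v (j - 1) \<Longrightarrow>
      vnorm (C *\<^sub>v x) \<le> sing_val C j * vnorm x"
    using sing_val_constraints[OF carriers(5) j(1) j'] by blast
  have "1 \<le> g * sing_val C j"
    using sing_val_C_lower mult_left_mono[OF sing_val_antimono[OF carriers(5) j k'] nonneg(4)]
    by linarith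
  then have sC: "s \<le> s * g * sing_val C j"
    using mult_left_mono[of 1 "g * sing_val C j" s] nonneg(3) by (simp add: mult_ac)
  show ?thesis
  proof (rule sing_val_le[OF carriers(4) j(1) j' F])
    show "j - 1 < j"
      using j by simp
    fix z :: "real vec" assume z: "z \<in> carrier_vec (k + l)" and Fz: "F *\<^sub>v z = 0\<^sub>v (j - 1)"
    have Cz: "C *\<^sub>v z \<in> carrier_vec (k + h)" and Ez: "E *\<^sub>v z \<in> carrier_vec (k + h)"
      using carriers(5,6) z by (auto intro: mult_mat_vec_carrier)
    have "vnorm (B *\<^sub>v z) \<le> vnorm (C *\<^sub>v z) + vnorm (E *\<^sub>v z)"
      unfolding B_eq add_mult_distrib_mat_vec[OF carriers(5,6) z]
      by (rule vnorm_triangle[OF Cz Ez])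
    also have "\<dots> \<le> sing_val C j * vnorm z + s * vnorm z"
      using FC[OF z Fz] E_bound[OF z] by simp
    also have "s * vnorm z \<le> s * g * sing_val C j * vnorm z"
      using sC by (intro mult_right_mono) auto
    finally show "vnorm (B *\<^sub>v z) \<le> (1 + s * g) * sing_val C j * vnorm z"
      by (simp add: algebra_simps)
  qed
qed

text \<open>
  The test space for \<open>B\<close> consists of the vectors \<open>(x - X y, y)\<close> with \<open>x\<close> arbitrary and \<open>y\<close>
  ranging over the lower parts of the leading \<open>j\<close> right singular directions of \<open>E\<close>; it has dimension
  \<open>k + j\<close> if \<open>\<sigma>\<^sub>j(E) > 0\<close>. On it, \<open>B\<close> takes
  the value \<open>(A11 x, Y A11 x + S y)\<close>. The first component controls \<open>x\<close> with factor \<open>g\<close>; together with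
  the second it controls \<open>S y\<close> with factor \<open>1 + a\<close>, hence \<open>y\<close>. The bound \<open>\<sigma>\<^sub>j(E) \<le> s\<close> makes the
  two estimates comparable.
\<close>
lemma sing_val_E_le_B:
  assumes j: "1 \<le> j" "j \<le> min h l"
  shows "sing_val E j \<le> (s * g + (1 + b) * (1 + a)) * sing_val B (k + j)"
proof (cases "sing_val E j = 0")
  case True
  then show ?thesis
    using sing_val_nonneg[OF carriers(4), of "k + j"] nonneg by simp
next
  case False
  define \<sigma> where "\<sigma> = sing_val E j"
  have \<sigma>: "0 < \<sigma>"
    using False sing_val_nonneg[OF carriers(6), of j] unfolding \<sigma>_def by simp
  have j': "j \<le> min (k + h) (k + l)" "1 \<le> k + j" "k + j \<le> min (k + h) (k + l)"
    using j by auto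
  have \<sigma>s: "\<sigma> \<le> s"
    unfolding \<sigma>_def
    by (rule sing_val_le[OF carriers(6) j(1) j'(1), of "0\<^sub>m 0 (k + l)" 0]) (use j E_bound in auto)
  obtain V where V: "V \<in> carrier_mat (k + l) j"
    and inj: "\<And>c. c \<in> carrier_vec j \<Longrightarrow> V *\<^sub>v c = 0\<^sub>v (k + l) \<Longrightarrow> c = 0\<^sub>v j"
    and low: "\<And>c. c \<in> carrier_vec j \<Longrightarrow> \<sigma> * vnorm (V *\<^sub>v c) \<le> vnorm (E *\<^sub>v (V *\<^sub>v c))"
    using sing_val_test_space[OF carriers(6) j(1) j'(1)] unfolding \<sigma>_def by blast
  \<comment> \<open>\<open>E\<close> sees only the last \<open>l\<close> coordinates of the range of \<open>V\<close>\<close>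
  define U where "U = mat l j (\<lambda>(i, t). V $$ (k + i, t))"
  have U: "U \<in> carrier_mat l j"
    by (simp add: U_def)
  have Uc: "U *\<^sub>v c \<in> carrier_vec l" if "c \<in> carrier_vec j" for c
    using U that by (rule mult_mat_vec_carrier)
  have VU: "\<exists>u \<in> carrier_vec k. V *\<^sub>v c = u @\<^sub>v (U *\<^sub>v c)" if c: "c \<in> carrier_vec j" for c
  proof (intro bexI)
    show "V *\<^sub>v c = vec_first (V *\<^sub>v c) k @\<^sub>v (U *\<^sub>v c)"
    proof (rule eq_vecI)
      fix i assume "i < dim_vec (vec_first (V *\<^sub>v c) k @\<^sub>v (U *\<^sub>v c))"
      then have i: "i < k + l"
        using U by simp
      have "row V i = row U (i - k)" if "\<not> i < k"
        using that i V by (intro eq_vecI) (auto simp: U_def)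
      then show "(V *\<^sub>v c) $ i = (vec_first (V *\<^sub>v c) k @\<^sub>v (U *\<^sub>v c)) $ i"
        using i V U by (cases "i < k") (auto simp: vec_first_def)
    qed (use V U in auto)
  qed simp
  have lowS: "\<sigma> * vnorm (V *\<^sub>v c) \<le> vnorm (S *\<^sub>v (U *\<^sub>v c))" if c: "c \<in> carrier_vec j" for c
  proof -
    obtain u where u: "u \<in> carrier_vec k" "V *\<^sub>v c = u @\<^sub>v (U *\<^sub>v c)"
      using VU[OF c] by blast
    then show ?thesis
      using low[OF c] E_mult_vec[OF u(1) Uc[OF c]] vnorm_append_zero(2)[of k] by simp
  qed
  define \<kappa> where "\<kappa> = s * g + (1 + b) * (1 + a)"
  \<comment> \<open>\<open>\<kappa>\<close> is divided by below, so it must be positive even when \<open>s * g = 0\<close>\<close>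
  have "1 * 1 \<le> (1 + b) * (1 + a)"
    using nonneg by (intro mult_mono) auto
  then have \<kappa>: "0 < \<kappa>"
    using nonneg by (auto simp: \<kappa>_def intro!: add_nonneg_pos)
  define W where "W = four_block_mat (1\<^sub>m k) (- (X * U)) (0\<^sub>m l k) U"
  have W: "W \<in> carrier_mat (k + l) (k + j)"
    unfolding W_def by (rule four_block_carrier_mat[OF _ U]) simp
  have XU: "- (X * U) \<in> carrier_mat k j"
    using carriers(1) U by simp
  have Wxc: "W *\<^sub>v (x @\<^sub>v c) = (x - X *\<^sub>v (U *\<^sub>v c)) @\<^sub>v (U *\<^sub>v c)"
    if x: "x \<in> carrier_vec k" and c: "c \<in> carrier_vec j" for x c
  proof -
    have "0\<^sub>m l k *\<^sub>v x = 0\<^sub>v l"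
      using x by (intro eq_vecI) auto
    moreover have "- (X * U) *\<^sub>v c = - (X *\<^sub>v (U *\<^sub>v c))"
      using assoc_mult_mat_vec[OF carriers(1) U c] carriers(1) U c by simp
    moreover have "X *\<^sub>v (U *\<^sub>v c) \<in> carrier_vec k"
      using carriers(1) Uc[OF c] by (rule mult_mat_vec_carrier)
    moreover have "v + - w = v - w" if "v \<in> carrier_vec k" "w \<in> carrier_vec k" for v w :: "real vec"
      using that by (intro eq_vecI) auto
    ultimately show ?thesis
      unfolding W_def four_block_mat_mult_vec[OF one_carrier_mat XU zero_carrier_mat U x c]
      using x Uc[OF c] by simp
  qed
  \<comment> \<open>\<open>W\<close> parametrises the test space by \<open>x\<close> and the coordinates \<open>c\<close> of \<open>y = U c\<close>\<close>
  have "\<sigma> / \<kappa> \<le> sing_val B (k + j)"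
  proof (rule sing_val_ge[OF carriers(4) j'(2,3) W])
    fix d :: "real vec" assume "d \<in> carrier_vec (k + j)"
    then obtain x c where x: "x \<in> carrier_vec k" and c: "c \<in> carrier_vec j" and d: "d = x @\<^sub>v c"
      using vec_split[of d k j] by blast
    define y where "y = U *\<^sub>v c"
    have y: "y \<in> carrier_vec l"
      unfolding y_def by (rule Uc[OF c])
    have Xy: "X *\<^sub>v y \<in> carrier_vec k"
      using carriers(1) y by (rule mult_mat_vec_carrier)
    have xXy: "x - X *\<^sub>v y \<in> carrier_vec k"
      using x Xy by simp
    have Wd: "W *\<^sub>v d = (x - X *\<^sub>v y) @\<^sub>v y"
      unfolding d y_def by (rule Wxc[OF x c])
    {
      assume "W *\<^sub>v d = 0\<^sub>v (k + l)"
      moreover have "0\<^sub>v (k + l) = 0\<^sub>v k @\<^sub>v (0\<^sub>v l :: real vec)"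
        by (intro eq_vecI) auto
      ultimately have "x - X *\<^sub>v y = 0\<^sub>v k" and y0: "y = 0\<^sub>v l"
        using append_vec_eq[OF xXy, of "0\<^sub>v k"] Wd by auto
      moreover have "X *\<^sub>v 0\<^sub>v l = 0\<^sub>v k"
        using carriers(1) by (auto intro!: eq_vecI)
      ultimately have x0: "x = 0\<^sub>v k"
        using x by simp
      have "S *\<^sub>v y = 0\<^sub>v h"
        using carriers(3) unfolding y0 by (auto intro!: eq_vecI)
      then have "\<sigma> * vnorm (V *\<^sub>v c) \<le> 0"
        using lowS[OF c] vnorm_eq_0_iff[of "S *\<^sub>v y" h] unfolding y_def by simp
      then have "vnorm (V *\<^sub>v c) = 0"
        using \<sigma> vnorm_nonneg[of "V *\<^sub>v c"] by (simp add: mult_le_0_iff)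
      then have "V *\<^sub>v c = 0\<^sub>v (k + l)"
        using vnorm_eq_0_iff[of "V *\<^sub>v c" "k + l"] V c by (auto intro: mult_mat_vec_carrier)
      then have "c = 0\<^sub>v j"
        by (rule inj[OF c])
      then show "d = 0\<^sub>v (k + j)"
        unfolding d x0 by (auto intro!: eq_vecI)
    }
    have Ax: "A11 *\<^sub>v x \<in> carrier_vec k"
      using A11 x by (rule mult_mat_vec_carrier)
    have YAx: "Y *\<^sub>v (A11 *\<^sub>v x) \<in> carrier_vec h"
      using carriers(2) Ax by (rule mult_mat_vec_carrier)
    have Sy: "S *\<^sub>v y \<in> carrier_vec h"
      using carriers(3) y by (rule mult_mat_vec_carrier)
    define \<beta> where "\<beta> = vnorm (B *\<^sub>v (W *\<^sub>v d))"
    have xx: "x - X *\<^sub>v y + X *\<^sub>v y = x"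
      by (rule minus_add_cancel_vec[OF x Xy])
    have \<beta>: "\<beta> = vnorm ((A11 *\<^sub>v x) @\<^sub>v (Y *\<^sub>v (A11 *\<^sub>v x) + S *\<^sub>v y))"
      unfolding \<beta>_def Wd B_mult_vec[OF xXy y] xx ..
    have \<beta>1: "vnorm (A11 *\<^sub>v x) \<le> \<beta>" and \<beta>2: "vnorm (Y *\<^sub>v (A11 *\<^sub>v x) + S *\<^sub>v y) \<le> \<beta>"
      unfolding \<beta> by (rule vnorm_append_ge)+
    have "S *\<^sub>v y = (Y *\<^sub>v (A11 *\<^sub>v x) + S *\<^sub>v y) - Y *\<^sub>v (A11 *\<^sub>v x)"
      by (rule add_minus_cancel_vec[OF YAx Sy, symmetric])
    then have "vnorm (S *\<^sub>v y) \<le> vnorm (Y *\<^sub>v (A11 *\<^sub>v x) + S *\<^sub>v y) + vnorm (Y *\<^sub>v (A11 *\<^sub>v x))"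
      using vnorm_triangle_minus[of "Y *\<^sub>v (A11 *\<^sub>v x) + S *\<^sub>v y" h "Y *\<^sub>v (A11 *\<^sub>v x)"] YAx Sy by simp
    also have "vnorm (Y *\<^sub>v (A11 *\<^sub>v x)) \<le> a * vnorm (A11 *\<^sub>v x)"
      using Y_bound[OF Ax] by (simp add: Y_def)
    also have "a * vnorm (A11 *\<^sub>v x) \<le> a * \<beta>"
      using nonneg(1) \<beta>1 by (rule mult_left_mono[rotated])
    finally have Sy_le: "vnorm (S *\<^sub>v y) \<le> (1 + a) * \<beta>"
      using \<beta>2 by (simp add: algebra_simps)
    have "vnorm y \<le> vnorm (V *\<^sub>v c)"
    proof -
      obtain u where "V *\<^sub>v c = u @\<^sub>v (U *\<^sub>v c)"
        using VU[OF c] by blast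
      then show ?thesis
        unfolding y_def by (simp add: vnorm_append_ge)
    qed
    then have "\<sigma> * vnorm y \<le> \<sigma> * vnorm (V *\<^sub>v c)"
      using \<sigma> by simp
    then have y_le: "\<sigma> * vnorm y \<le> (1 + a) * \<beta>"
      using lowS[OF c] Sy_le unfolding y_def by linarith
    have "vnorm x \<le> g * \<beta>"
      using vnorm_le_A11[OF x] mult_left_mono[OF \<beta>1 nonneg(4)] by linarith
    then have x_le: "\<sigma> * vnorm x \<le> s * (g * \<beta>)"
      using \<sigma> \<sigma>s nonneg(3) by (intro mult_mono) auto
    have "vnorm (W *\<^sub>v d) \<le> vnorm (x - X *\<^sub>v y) + vnorm y"
      unfolding Wd by (rule vnorm_append_le)
    also have "vnorm (x - X *\<^sub>v y) \<le> vnorm x + vnorm (X *\<^sub>v y)"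
      by (rule vnorm_triangle_minus[OF x Xy])
    also have "vnorm (X *\<^sub>v y) \<le> b * vnorm y"
      using X_bound[OF y] by (simp add: X_def)
    finally have "vnorm (W *\<^sub>v d) \<le> vnorm x + (1 + b) * vnorm y"
      by (simp add: algebra_simps)
    then have "\<sigma> * vnorm (W *\<^sub>v d) \<le> \<sigma> * (vnorm x + (1 + b) * vnorm y)"
      using \<sigma> by (intro mult_left_mono) auto
    also have "\<dots> = \<sigma> * vnorm x + (1 + b) * (\<sigma> * vnorm y)"
      by (simp add: algebra_simps)
    also have "\<dots> \<le> s * (g * \<beta>) + (1 + b) * ((1 + a) * \<beta>)"
      using x_le y_le nonneg(2) by (intro add_mono mult_left_mono) auto
    also have "\<dots> = \<kappa> * \<beta>"
      by (simp add: \<kappa>_def algebra_simps)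
    finally show "\<sigma> / \<kappa> * vnorm (W *\<^sub>v d) \<le> vnorm (B *\<^sub>v (W *\<^sub>v d))"
      using \<kappa> unfolding \<beta>_def by (simp add: field_simps)
  qed
  then show ?thesis
    using \<kappa> unfolding \<sigma>_def \<kappa>_def by (simp add: field_simps)
qed

lemma B_lu_factorisation:
  "B = four_block_mat (1\<^sub>m k) (0\<^sub>m k h) Y (1\<^sub>m h) * four_block_mat A11 A12 (0\<^sub>m h k) S"
proof -
  have YA12: "Y * A12 + S = A22"
    unfolding Y_def S_def using A21 A12 A22 G(1) by (intro eq_matI) auto
  have "four_block_mat (1\<^sub>m k) (0\<^sub>m k h) Y (1\<^sub>m h) * four_block_mat A11 A12 (0\<^sub>m h k) S =
      four_block_mat (1\<^sub>m k * A11 + 0\<^sub>m k h * 0\<^sub>m h k) (1\<^sub>m k * A12 + 0\<^sub>m k h * S)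
        (Y * A11 + 1\<^sub>m h * 0\<^sub>m h k) (Y * A12 + 1\<^sub>m h * S)"
    by (rule mult_four_block_mat[OF one_carrier_mat zero_carrier_mat carriers(2) one_carrier_mat
        A11 A12 zero_carrier_mat carriers(3)])
  then show ?thesis
    unfolding B_def using A11 A12 A21 carriers(3) by (simp add: Y_mult_A11 YA12)
qed

lemma C_factorisation:
  obtains K L where "K \<in> carrier_mat (k + h) k" "L \<in> carrier_mat k (k + l)" "C = K * L"
proof -
  define K where "K = four_block_mat (1\<^sub>m k) (0\<^sub>m k 0) Y (0\<^sub>m h 0)"
  define L where "L = four_block_mat A11 A12 (0\<^sub>m 0 k) (0\<^sub>m 0 l)"
  have K: "K \<in> carrier_mat (k + h) (k + 0)"
    unfolding K_def by (rule four_block_carrier_mat) auto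
  have L: "L \<in> carrier_mat (k + 0) (k + l)"
    unfolding L_def by (rule four_block_carrier_mat) (use A11 in auto)
  have z: "0\<^sub>m r 0 * 0\<^sub>m 0 c = (0\<^sub>m r c :: real mat)" for r c
    by (intro eq_matI) auto
  have "K * L = four_block_mat (1\<^sub>m k * A11 + 0\<^sub>m k 0 * 0\<^sub>m 0 k) (1\<^sub>m k * A12 + 0\<^sub>m k 0 * 0\<^sub>m 0 l)
        (Y * A11 + 0\<^sub>m h 0 * 0\<^sub>m 0 k) (Y * A12 + 0\<^sub>m h 0 * 0\<^sub>m 0 l)"
    unfolding K_def L_def
    by (rule mult_four_block_mat[OF one_carrier_mat zero_carrier_mat carriers(2) zero_carrier_mat
        A11 A12 zero_carrier_mat zero_carrier_mat])
  then have "K * L = C"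
    unfolding C_def z Y_mult_A11 using A11 A12 A21 carriers(7) by (simp add: Y_def)
  then show ?thesis
    using that K L by simp
qed

end

section \<open>Determinants after a row and a column exchange\<close>

lemma abs_det_permute:
  fixes M :: "real mat"
  assumes M: "M \<in> carrier_mat k k" and \<pi>: "\<pi> permutes {0..<k}" and \<rho>: "\<rho> permutes {0..<k}"
  shows "\<bar>det (mat k k (\<lambda>(i, j). M $$ (\<pi> i, \<rho> j)))\<bar> = \<bar>det M\<bar>"
proof -
  have rows: "\<bar>det (mat k k (\<lambda>(i, j). N $$ (\<tau> i, j)))\<bar> = \<bar>det N\<bar>"
    if "N \<in> carrier_mat k k" "\<tau> permutes {0..<k}" for N :: "real mat" and \<tau>
    using det_permute_rows[OF that] by (simp add: abs_mult sign_def)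
  define N where "N = mat k k (\<lambda>(i, j). M $$ (\<pi> i, j))"
  have N: "N \<in> carrier_mat k k"
    by (simp add: N_def)
  have "mat k k (\<lambda>(i, j). M $$ (\<pi> i, \<rho> j)) =
      transpose_mat (mat k k (\<lambda>(i, j). transpose_mat N $$ (\<rho> i, j)))"
    using permutes_in_image[OF \<rho>] by (intro eq_matI) (auto simp: N_def)
  then have "\<bar>det (mat k k (\<lambda>(i, j). M $$ (\<pi> i, \<rho> j)))\<bar> =
      \<bar>det (mat k k (\<lambda>(i, j). transpose_mat N $$ (\<rho> i, j)))\<bar>"
    by (simp add: det_transpose[of _ k])
  also have "\<dots> = \<bar>det N\<bar>"
    using rows[OF _ \<rho>, of "transpose_mat N"] N by (simp add: det_transpose)
  also have "\<dots> = \<bar>det M\<bar>"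
    using rows[OF M \<pi>] by (simp add: N_def)
  finally show ?thesis .
qed

text \<open>
  A submatrix lists its rows in increasing order, through \<open>pick\<close>, whereas a pivot block may list
  them in any order; the two differ by a permutation, which does not affect \<open>\<bar>det\<bar>\<close>.
\<close>
lemma enumeration_as_pick:
  assumes f: "inj_on f {..<k}"
  obtains \<pi> where "\<pi> permutes {0..<k}" "\<And>i. i < k \<Longrightarrow> pick (f ` {..<k}) (\<pi> i) = f i"
proof -
  define I where "I = f ` {..<k}"
  have card: "card I = k"
    using f by (simp add: I_def card_image)
  have inj: "inj_on (pick I) {..<k}"
  proof (rule inj_onI)
    fix i j assume "i \<in> {..<k}" "j \<in> {..<k}" "pick I i = pick I j"
    then show "i = j"
      using pick_mono_le[of i I j] pick_mono_le[of j I i] card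
      by (metis lessThan_iff less_irrefl linorder_neqE_nat)
  qed
  have img: "pick I ` {..<k} = I"
  proof (rule card_subset_eq)
    show "finite I"
      by (simp add: I_def)
    show "pick I ` {..<k} \<subseteq> I"
      using pick_in_set_le[of _ I] card by auto
    show "card (pick I ` {..<k}) = card I"
      using card_image[OF inj] card by simp
  qed
  define \<pi> where "\<pi> i = (if i < k then inv_into {..<k} (pick I) (f i) else i)" for i
  have fI: "f i \<in> pick I ` {..<k}" if "i < k" for i
    using that unfolding img by (simp add: I_def)
  have pick: "pick I (\<pi> i) = f i" if "i < k" for i
    using that f_inv_into_f[OF fI[OF that]] by (simp add: \<pi>_def)
  have "\<pi> permutes {0..<k}"
  proof (rule bij_imp_permutes)
    have "inj_on \<pi> {0..<k}"
    proof (rule inj_onI)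
      fix i j assume "i \<in> {0..<k}" "j \<in> {0..<k}" "\<pi> i = \<pi> j"
      then show "i = j"
        using pick[of i] pick[of j] f by (auto dest: inj_onD)
    qed
    moreover have "\<pi> ` {0..<k} \<subseteq> {0..<k}"
      using inv_into_into[OF fI] by (auto simp: \<pi>_def)
    ultimately show "bij_betw \<pi> {0..<k} {0..<k}"
      by (simp add: bij_betw_def endo_inj_surj)
  qed (simp add: \<pi>_def)
  then show ?thesis
    using that pick unfolding I_def by blast
qed

lemma vol_submatrix:
  assumes A: "A \<in> carrier_mat m n"
    and f: "inj_on f {..<k}" "f ` {..<k} \<subseteq> {..<m}"
    and g: "inj_on g {..<k}" "g ` {..<k} \<subseteq> {..<n}"
  shows "vol (submatrix A (f ` {..<k}) (g ` {..<k})) = \<bar>det (mat k k (\<lambda>(i, j). A $$ (f i, g j)))\<bar>"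
proof -
  obtain \<pi> where \<pi>: "\<pi> permutes {0..<k}" "\<And>i. i < k \<Longrightarrow> pick (f ` {..<k}) (\<pi> i) = f i"
    using enumeration_as_pick[OF f(1)] by blast
  obtain \<rho> where \<rho>: "\<rho> permutes {0..<k}" "\<And>i. i < k \<Longrightarrow> pick (g ` {..<k}) (\<rho> i) = g i"
    using enumeration_as_pick[OF g(1)] by blast
  define M where "M = submatrix A (f ` {..<k}) (g ` {..<k})"
  have "{i. i < dim_row A \<and> i \<in> f ` {..<k}} = f ` {..<k}"
    "{i. i < dim_col A \<and> i \<in> g ` {..<k}} = g ` {..<k}"
    using A f(2) g(2) by auto
  then have M_eq: "M = mat k k (\<lambda>(i, j). A $$ (pick (f ` {..<k}) i, pick (g ` {..<k}) j))"
    using f(1) g(1) unfolding M_def submatrix_def by (simp add: card_image)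
  have M: "M \<in> carrier_mat k k"
    by (simp add: M_eq)
  have "mat k k (\<lambda>(i, j). M $$ (\<pi> i, \<rho> j)) = mat k k (\<lambda>(i, j). A $$ (f i, g j))"
    using permutes_in_image[OF \<pi>(1)] permutes_in_image[OF \<rho>(1)] \<pi>(2) \<rho>(2)
    by (intro eq_matI) (auto simp: M_eq)
  then show ?thesis
    using abs_det_permute[OF M \<pi>(1) \<rho>(1)] vol_eq_abs_det[OF M] unfolding M_def by simp
qed

text \<open>
  A choice of \<open>k\<close> distinct indices below \<open>m\<close>, relative to the leading ones \<open>0, \<dots>, k - 1\<close> which
  enumerate the pivot: at most one of the chosen indices is new.
\<close>
definition exchange :: "nat \<Rightarrow> nat \<Rightarrow> (nat \<Rightarrow> nat) \<Rightarrow> bool" where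
  "exchange k m \<sigma> \<longleftrightarrow> inj_on \<sigma> {..<k} \<and> \<sigma> ` {..<k} \<subseteq> {..<m} \<and> card (\<sigma> ` {..<k} - {..<k}) \<le> 1"

lemma exchange_id: "k \<le> m \<Longrightarrow> exchange k m (\<lambda>i. i)"
  by (auto simp: exchange_def)

lemma exchange_upd:
  assumes "k \<le> c" "c < m"
  shows "exchange k m (\<lambda>i. if i = r then c else i)"
proof -
  let ?\<sigma> = "\<lambda>i. if i = r then c else i"
  have "card (?\<sigma> ` {..<k} - {..<k}) \<le> card {c}"
    by (rule card_mono) auto
  then show ?thesis
    using assms by (auto simp: exchange_def inj_on_def)
qed

lemma exchange_permutes:
  assumes "exchange k m \<sigma>" "p permutes {..<m}"
  shows "inj_on (\<lambda>i. p (\<sigma> i)) {..<k}" "(\<lambda>i. p (\<sigma> i)) ` {..<k} \<subseteq> {..<m}"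
    "card ((\<lambda>i. p (\<sigma> i)) ` {..<k} - p ` {..<k}) \<le> 1"
proof -
  have p: "inj p"
    using assms(2) by (rule permutes_inj)
  show "inj_on (\<lambda>i. p (\<sigma> i)) {..<k}"
    using assms(1) by (auto simp: exchange_def inj_on_def inj_eq[OF p])
  show "(\<lambda>i. p (\<sigma> i)) ` {..<k} \<subseteq> {..<m}"
    using assms permutes_in_image[OF assms(2)] by (auto simp: exchange_def)
  have "(\<lambda>i. p (\<sigma> i)) ` {..<k} - p ` {..<k} = p ` (\<sigma> ` {..<k} - {..<k})"
    by (auto simp: inj_eq[OF p])
  then have "card ((\<lambda>i. p (\<sigma> i)) ` {..<k} - p ` {..<k}) = card (\<sigma> ` {..<k} - {..<k})"
    using p by (simp add: card_image inj_on_subset)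
  then show "card ((\<lambda>i. p (\<sigma> i)) ` {..<k} - p ` {..<k}) \<le> 1"
    using assms(1) by (simp add: exchange_def)
qed

lemma local_max_vol_exchange:
  assumes A: "A \<in> carrier_mat m n" and lmv: "local_max_vol A (p ` {..<k}) (q ` {..<k})"
    and p: "p permutes {..<m}" and q: "q permutes {..<n}" and k: "k \<le> m" "k \<le> n"
    and \<sigma>: "exchange k m \<sigma>" and \<tau>: "exchange k n \<tau>"
  shows "\<bar>det (mat k k (\<lambda>(i, j). A $$ (p (\<sigma> i), q (\<tau> j))))\<bar>
      \<le> \<bar>det (mat k k (\<lambda>(i, j). A $$ (p i, q j)))\<bar>"
    and "0 < \<bar>det (mat k k (\<lambda>(i, j). A $$ (p i, q j)))\<bar>"
proof -
  note s = exchange_permutes[OF \<sigma> p] and t = exchange_permutes[OF \<tau> q]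
  note s0 = exchange_permutes[OF exchange_id[OF k(1)] p]
    and t0 = exchange_permutes[OF exchange_id[OF k(2)] q]
  note v0 = vol_submatrix[OF A s0(1,2) t0(1,2)]
  show "0 < \<bar>det (mat k k (\<lambda>(i, j). A $$ (p i, q j)))\<bar>"
    using lmv unfolding local_max_vol_def v0 by blast
  let ?I = "(\<lambda>i. p (\<sigma> i)) ` {..<k}" and ?J = "(\<lambda>i. q (\<tau> i)) ` {..<k}"
  have "card ?I = card (p ` {..<k})" "card ?J = card (q ` {..<k})"
    using s(1) t(1) s0(1) t0(1) by (simp_all add: card_image)
  then have "vol (submatrix A ?I ?J) \<le> vol (submatrix A (p ` {..<k}) (q ` {..<k}))"
    using lmv s(2,3) t(2,3) A unfolding local_max_vol_def by auto
  then show "\<bar>det (mat k k (\<lambda>(i, j). A $$ (p (\<sigma> i), q (\<tau> j))))\<bar>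
      \<le> \<bar>det (mat k k (\<lambda>(i, j). A $$ (p i, q j)))\<bar>"
    unfolding v0 vol_submatrix[OF A s(1,2) t(1,2)] .
qed

text \<open>
  Cramer's rule, for a new column that is a combination of the columns of \<open>M\<close>.
\<close>
lemma det_replace_col_mult:
  fixes M X :: "real mat"
  assumes M: "M \<in> carrier_mat k k" and X: "X \<in> carrier_mat k l" and "t < k" "j < l"
  shows "det (mat k k (\<lambda>(a, b). if b = t then (M * X) $$ (a, j) else M $$ (a, b))) = X $$ (t, j) * det M"
proof -
  have "mat k k (\<lambda>(a, b). if b = t then (M * X) $$ (a, j) else M $$ (a, b)) =
      replace_col M (M *\<^sub>v col X j) t"
    using assms by (intro eq_matI) (auto simp: replace_col_def)
  moreover have "col X j \<in> carrier_vec k"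
    using X by auto
  ultimately show ?thesis
    using cramer_lemma_mat[OF M _ assms(3)] assms by simp
qed

lemma det_replace_row_mult:
  fixes M Y :: "real mat"
  assumes M: "M \<in> carrier_mat k k" and Y: "Y \<in> carrier_mat h k" and "r < k" "i < h"
  shows "det (mat k k (\<lambda>(a, b). if a = r then (Y * M) $$ (i, b) else M $$ (a, b))) = Y $$ (i, r) * det M"
proof -
  have "mat k k (\<lambda>(a, b). if a = r then (Y * M) $$ (i, b) else M $$ (a, b)) =
      transpose_mat (mat k k (\<lambda>(a, b). if b = r then (transpose_mat M * transpose_mat Y) $$ (a, i)
        else transpose_mat M $$ (a, b)))"
    using assms by (intro eq_matI) (auto simp flip: transpose_mult[OF Y M])
  then show ?thesis
    using det_replace_col_mult[of "transpose_mat M" k "transpose_mat Y" h r i] assms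
    by (simp add: det_transpose[of _ k])
qed

text \<open>
  Were the corner entry of the exchanged block \<open>(A21 * G * A12)(i, j)\<close> instead of \<open>A22(i, j)\<close>, the block
  would arise from \<open>A11\<close> by a row replacement followed by a column replacement, and Cramer's rule,
  used twice, would give the first summand. Changing the corner by \<open>S(i, j)\<close> adds \<open>S(i, j)\<close> times a
  cofactor of \<open>A11\<close>, that is, an entry of the adjugate \<open>det A11 \<cdot> G\<close>.
\<close>
lemma det_exchange_row_col:
  fixes A11 G :: "real mat"
  assumes A11: "A11 \<in> carrier_mat k k" and A12: "A12 \<in> carrier_mat k l"
    and A21: "A21 \<in> carrier_mat h k" and A22: "A22 \<in> carrier_mat h l"
    and G: "G \<in> carrier_mat k k" "A11 * G = 1\<^sub>m k" "G * A11 = 1\<^sub>m k"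
    and idx: "r < k" "t < k" "i < h" "j < l"
  shows "det (mat k k (\<lambda>(a, b).
      if a = r then (if b = t then A22 $$ (i, j) else A21 $$ (i, b))
      else (if b = t then A12 $$ (a, j) else A11 $$ (a, b)))) =
    det A11 * ((A21 * G) $$ (i, r) * (G * A12) $$ (t, j) +
      (A22 - A21 * G * A12) $$ (i, j) * G $$ (t, r))"
proof -
  define X Y where "X = G * A12" and "Y = A21 * G"
  have X: "X \<in> carrier_mat k l" and Y: "Y \<in> carrier_mat h k"
    using A12 A21 G by (auto simp: X_def Y_def)
  have AX: "A11 * X = A12"
    unfolding X_def using assoc_mult_mat[OF A11 G(1) A12] G(2) A12 by simp
  have YA: "Y * A11 = A21"
    unfolding Y_def using assoc_mult_mat[OF A21 G(1) A11] G(3) A21 by simp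
  define R where "R = mat k k (\<lambda>(a, b). if a = r then A21 $$ (i, b) else A11 $$ (a, b))"
  have R: "R \<in> carrier_mat k k"
    by (simp add: R_def)
  have detR: "det R = Y $$ (i, r) * det A11"
    using det_replace_row_mult[OF A11 Y idx(1,3)] unfolding YA R_def .
  define N where "N = mat k k (\<lambda>(a, b). if b = t then (R * X) $$ (a, j) else R $$ (a, b))"
  have N: "N \<in> carrier_mat k k"
    by (simp add: N_def)
  have detN: "det N = X $$ (t, j) * det R"
    using det_replace_col_mult[OF R X idx(2,4)] by (simp add: N_def)
  define M where "M = mat k k (\<lambda>(a, b).
      if a = r then (if b = t then A22 $$ (i, j) else A21 $$ (i, b))
      else (if b = t then A12 $$ (a, j) else A11 $$ (a, b)))"
  have M: "M \<in> carrier_mat k k"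
    by (simp add: M_def)
  \<comment> \<open>\<open>M\<close> and \<open>N\<close> differ only in column \<open>t\<close>, in fact only at \<open>(r, t)\<close>\<close>
  have cof: "cofactor M a t = cofactor N a t" if "a < k" for a
  proof -
    have "mat_delete M a t = mat_delete N a t"
      using that idx by (intro eq_matI) (auto simp: mat_delete_def M_def N_def R_def)
    then show ?thesis
      by (simp add: cofactor_def)
  qed
  have "mat_delete M r t = mat_delete A11 r t"
    using A11 idx by (intro eq_matI) (auto simp: mat_delete_def M_def)
  then have "cofactor M r t = adj_mat A11 $$ (t, r)"
    using A11 idx by (simp add: cofactor_def adj_mat_def)
  also have "adj_mat A11 = G * (A11 * adj_mat A11)"
    using assoc_mult_mat[OF G(1) A11 adj_mat(1)[OF A11]] adj_mat(1)[OF A11] G(3) by simp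
  also have "\<dots> = det A11 \<cdot>\<^sub>m G"
    unfolding adj_mat(2)[OF A11] using G(1)
    by (simp add: mult_smult_distrib[of _ k k _ k])
  finally have cofr: "cofactor M r t = det A11 * G $$ (t, r)"
    using G(1) idx by simp
  have Nr: "N $$ (r, t) = (A21 * X) $$ (i, j)"
  proof -
    have "row R r = row A21 i"
      using A21 idx by (intro eq_vecI) (auto simp: R_def)
    then show ?thesis
      using A21 R X idx by (simp add: N_def)
  qed
  \<comment> \<open>away from row \<open>r\<close> the new column of \<open>N\<close> is that of \<open>A11 * X = A12\<close>\<close>
  have Na: "N $$ (a, t) = M $$ (a, t)" if "a < k" "a \<noteq> r" for a
  proof -
    have "row R a = row A11 a"
      using A11 that by (intro eq_vecI) (auto simp: R_def)
    then have "(R * X) $$ (a, j) = (A11 * X) $$ (a, j)"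
      using A11 R X idx that by simp
    then show ?thesis
      using that idx by (simp add: N_def M_def AX)
  qed
  have "A21 * X = A21 * G * A12"
    unfolding X_def using assoc_mult_mat[OF A21 G(1) A12] by simp
  then have Mr: "M $$ (r, t) - N $$ (r, t) = (A22 - A21 * G * A12) $$ (i, j)"
    unfolding Nr using A21 A22 A12 G(1) idx by (simp add: M_def)
  have "det M - det N = (\<Sum>a<k. (M $$ (a, t) - N $$ (a, t)) * cofactor M a t)"
    unfolding laplace_expansion_column[OF M idx(2)] laplace_expansion_column[OF N idx(2)]
    by (simp add: cof left_diff_distrib sum_subtractf)
  also have "\<dots> = (M $$ (r, t) - N $$ (r, t)) * cofactor M r t"
    using idx Na by (subst sum.remove[of _ r]) auto
  finally have "det M = det N + (A22 - A21 * G * A12) $$ (i, j) * (det A11 * G $$ (t, r))"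
    unfolding Mr cofr by simp
  then show ?thesis
    unfolding M_def[symmetric] detN detR X_def Y_def by (simp add: algebra_simps)
qed

section \<open>Permutation matrices, inverses, entrywise norms and rank\<close>

lemma perm_mat_carrier [simp]: "perm_mat n p \<in> carrier_mat n n"
  by (simp add: perm_mat_def)

lemma perm_mat_mult_index:
  assumes A: "A \<in> carrier_mat m n" and p: "p permutes {..<m}" and i: "i < m" "j < n"
  shows "(perm_mat m p * A) $$ (i, j) = A $$ (p i, j)"
proof -
  have pi: "p i < m"
    using permutes_in_image[OF p, of i] i by simp
  have "(perm_mat m p * A) $$ (i, j) = (\<Sum>l<m. (if l = p i then 1 else 0) * A $$ (l, j))"
    using A i by (simp add: perm_mat_def scalar_prod_def atLeast0LessThan)
  also have "\<dots> = A $$ (p i, j)"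
    using pi by (subst sum.remove[of _ "p i"]) auto
  finally show ?thesis .
qed

lemma perm_mat_both_index:
  assumes A: "A \<in> carrier_mat m n" and p: "p permutes {..<m}" and q: "q permutes {..<n}"
    and ij: "i < m" "j < n"
  shows "(perm_mat m p * A * transpose_mat (perm_mat n q)) $$ (i, j) = A $$ (p i, q j)"
proof -
  define N where "N = perm_mat m p * A"
  have N: "N \<in> carrier_mat m n"
    unfolding N_def using perm_mat_carrier A by (rule mult_carrier_mat)
  have qj: "q j < n"
    using permutes_in_image[OF q, of j] ij by simp
  have "N * transpose_mat (perm_mat n q) = transpose_mat (perm_mat n q * transpose_mat N)"
    using transpose_mult[OF perm_mat_carrier, of "transpose_mat N" n m q] N by simp
  then have "(N * transpose_mat (perm_mat n q)) $$ (i, j) = (perm_mat n q * transpose_mat N) $$ (j, i)"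
    using ij N by (simp add: perm_mat_def)
  also have "\<dots> = transpose_mat N $$ (q j, i)"
    by (rule perm_mat_mult_index[OF _ q]) (use N ij in auto)
  also have "\<dots> = N $$ (i, q j)"
    using N ij qj by simp
  also have "\<dots> = A $$ (p i, q j)"
    unfolding N_def by (rule perm_mat_mult_index[OF A p ij(1) qj])
  finally show ?thesis
    by (simp add: N_def)
qed

lemma perm_mat_orthogonal:
  assumes p: "p permutes {..<n}"
  shows "perm_mat n p * transpose_mat (perm_mat n p) = 1\<^sub>m n"
    and "transpose_mat (perm_mat n p) * perm_mat n p = 1\<^sub>m n"
proof -
  have T: "transpose_mat (perm_mat n p) \<in> carrier_mat n n"
    by simp
  show *: "perm_mat n p * transpose_mat (perm_mat n p) = 1\<^sub>m n"
  proof (rule eq_matI)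
    fix i j assume ij: "i < dim_row (1\<^sub>m n)" "j < dim_col (1\<^sub>m n)"
    then have "(perm_mat n p * transpose_mat (perm_mat n p)) $$ (i, j) =
        transpose_mat (perm_mat n p) $$ (p i, j)"
      by (intro perm_mat_mult_index[OF T p]) auto
    also have "\<dots> = 1\<^sub>m n $$ (i, j)"
      using ij permutes_in_image[OF p, of i] inj_eq[OF permutes_inj[OF p], of i j]
      by (auto simp: perm_mat_def)
    finally show "(perm_mat n p * transpose_mat (perm_mat n p)) $$ (i, j) = 1\<^sub>m n $$ (i, j)" .
  qed (auto simp: perm_mat_def)
  show "transpose_mat (perm_mat n p) * perm_mat n p = 1\<^sub>m n"
    by (rule mat_mult_left_right_inverse[OF perm_mat_carrier T *])
qed

lemma mat_inv:
  assumes A: "A \<in> carrier_mat n n" and det: "det A \<noteq> 0"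
  shows "mat_inv A \<in> carrier_mat n n" "A * mat_inv A = 1\<^sub>m n" "mat_inv A * A = 1\<^sub>m n"
proof -
  have "mat_inverse A \<noteq> None"
    using mat_inverse(1)[OF A, of "()"] det_non_zero_imp_unit[OF A det, of "()"] by blast
  then obtain N where N: "mat_inverse A = Some N"
    by auto
  show "mat_inv A \<in> carrier_mat n n" "A * mat_inv A = 1\<^sub>m n" "mat_inv A * A = 1\<^sub>m n"
    using mat_inverse(2)[OF A N] by (simp_all add: mat_inv_def N)
qed

lemma max_norm_upper:
  assumes "M \<in> carrier_mat r c" "i < r" "j < c"
  shows "\<bar>M $$ (i, j)\<bar> \<le> max_norm M"
proof -
  have "M $$ (i, j) \<in> elements_mat M"
    using assms by auto
  moreover have "finite (elements_mat M)"
    by (simp add: elements_mat_def)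
  ultimately show ?thesis
    unfolding max_norm_def by (auto intro!: Max_ge)
qed

lemma max_norm_attained:
  assumes M: "M \<in> carrier_mat r c"
  obtains "max_norm M = 0" | i j where "i < r" "j < c" "max_norm M = \<bar>M $$ (i, j)\<bar>"
proof (cases "elements_mat M = {}")
  case True
  then show ?thesis
    using that(1) by (simp add: max_norm_def)
next
  case False
  have "finite (elements_mat M)"
    by (simp add: elements_mat_def)
  then have "max_norm M \<in> abs ` elements_mat M"
    using False unfolding max_norm_def by (auto intro!: Max_in)
  then obtain i j where "i < dim_row M" "j < dim_col M" "max_norm M = \<bar>M $$ (i, j)\<bar>"
    by (auto simp: elements_mat_def)
  then show ?thesis
    using that(2) M by auto
qed

lemma max_norm_le:
  assumes M: "M \<in> carrier_mat r c" and e: "\<And>i j. i < r \<Longrightarrow> j < c \<Longrightarrow> \<bar>M $$ (i, j)\<bar> \<le> e" and "0 \<le> e"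
  shows "max_norm M \<le> e"
  using M
proof (cases rule: max_norm_attained)
  case (2 i j)
  then show ?thesis
    using e by simp
qed (use assms in simp)

lemma max_norm_nonneg:
  assumes M: "M \<in> carrier_mat r c"
  shows "0 \<le> max_norm M"
  using M by (cases rule: max_norm_attained) auto

text \<open>
  Both norms are attained at entries, except that an empty matrix has norm 0; there \<open>0 \<le> e\<close> suffices.
\<close>
lemma max_norm_mult_le:
  assumes M: "M \<in> carrier_mat r c" and N: "N \<in> carrier_mat r' c'" and "0 \<le> e"
    and e: "\<And>i j i' j'. i < r \<Longrightarrow> j < c \<Longrightarrow> i' < r' \<Longrightarrow> j' < c' \<Longrightarrow>
      \<bar>M $$ (i, j)\<bar> * \<bar>N $$ (i', j')\<bar> \<le> e"
  shows "max_norm M * max_norm N \<le> e"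
  using M
proof (cases rule: max_norm_attained)
  case (2 i j)
  note ij = this
  show ?thesis
    using N by (cases rule: max_norm_attained) (use ij e assms(3) in auto)
qed (use assms in simp)

text \<open>
  A product with inner dimension \<open>k\<close> is a sum of \<open>k\<close> outer products, each of rank at most 1.
\<close>
lemma (in vec_space) rank_mult_le:
  assumes "K \<in> carrier_mat n k" "L \<in> carrier_mat k nc"
  shows "rank (K * L) \<le> k"
proof -
  define N where "N d = mat n nc (\<lambda>(i, j). \<Sum>l<d. K $$ (i, l) * L $$ (l, j))" for d
  have "rank (N d) \<le> d" for d
  proof (induction d)
    case 0
    have "N 0 = 0\<^sub>m n nc"
      by (intro eq_matI) (auto simp: N_def)
    then show ?case
      by (simp add: rank_0I)
  next
    case (Suc d)
    define R where "R = mat n nc (\<lambda>(i, j). K $$ (i, d) * L $$ (d, j))"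
    have R: "R \<in> carrier_mat n nc" and Nd: "N d \<in> carrier_mat n nc"
      by (simp_all add: R_def N_def)
    have "N (Suc d) = N d + R"
      by (intro eq_matI) (auto simp: N_def R_def)
    moreover have "rank R \<le> 1"
      by (rule rank_le_1_product_entries[OF R, of "\<lambda>i. K $$ (i, d)" "\<lambda>j. L $$ (d, j)"])
        (auto simp: R_def)
    ultimately show ?case
      using rank_subadditive[OF Nd R] Suc by simp
  qed
  moreover have "K * L = N k"
    using assms by (intro eq_matI) (auto simp: N_def scalar_prod_def atLeast0LessThan)
  ultimately show ?thesis
    by simp
qed

section \<open>Local maximum volume pivoting\<close>

text \<open>
  Each exchange changes \<open>det A11\<close> by an explicit factor, and local maximality says that this factor has
  absolute value at most 1. A row exchange yields the bound for \<open>A21 * G\<close>, a column exchange that for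
  \<open>G * A12\<close>. For a simultaneous exchange the factor is \<open>\<xi> + \<zeta>\<close> with \<open>\<bar>\<xi>\<bar> \<le> 1\<close> already known,
  so \<open>\<bar>\<zeta>\<bar> \<le> 2\<close>.
\<close>
lemma max_norm_bounds_of_local_max_vol:
  assumes A: "A \<in> carrier_mat (k + h) (k + l)"
    and lmv: "local_max_vol A (p ` {..<k}) (q ` {..<k})"
    and p: "p permutes {..<k + h}" and q: "q permutes {..<k + l}"
    and A11: "A11 \<in> carrier_mat k k" and A12: "A12 \<in> carrier_mat k l"
    and A21: "A21 \<in> carrier_mat h k" and A22: "A22 \<in> carrier_mat h l"
    and blocks: "perm_mat (k + h) p * A * transpose_mat (perm_mat (k + l) q) =
      four_block_mat A11 A12 A21 A22"
  shows "det A11 \<noteq> 0"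
    and "max_norm (A21 * mat_inv A11) \<le> 1" and "max_norm (mat_inv A11 * A12) \<le> 1"
    and "max_norm (A22 - A21 * mat_inv A11 * A12) * max_norm (mat_inv A11) \<le> 2"
proof -
  have entry: "A $$ (p i, q j) =
      (if i < k then if j < k then A11 $$ (i, j) else A12 $$ (i, j - k)
       else if j < k then A21 $$ (i - k, j) else A22 $$ (i - k, j - k))"
    if "i < k + h" "j < k + l" for i j
  proof -
    have "A $$ (p i, q j) = four_block_mat A11 A12 A21 A22 $$ (i, j)"
      using perm_mat_both_index[OF A p q that] unfolding blocks ..
    then show ?thesis
      using that A11 A22 by (auto simp: four_block_mat_def Let_def)
  qed
  have A11_eq: "mat k k (\<lambda>(i, j). A $$ (p i, q j)) = A11"
    using A11 by (intro eq_matI) (auto simp: entry)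
  have k: "k \<le> k + h" "k \<le> k + l"
    by auto
  note max = local_max_vol_exchange[OF A lmv p q k, unfolded A11_eq]
  show det0: "det A11 \<noteq> 0"
    using max(2)[OF exchange_id[OF k(1)] exchange_id[OF k(2)]] by simp
  define G where "G = mat_inv A11"
  have G: "G \<in> carrier_mat k k" "A11 * G = 1\<^sub>m k" "G * A11 = 1\<^sub>m k"
    using mat_inv[OF A11 det0] by (simp_all add: G_def)
  have Y: "A21 * G \<in> carrier_mat h k" and X: "G * A12 \<in> carrier_mat k l"
    and S: "A22 - A21 * G * A12 \<in> carrier_mat h l"
    using A21 A12 A22 G by auto
  have YA: "A21 * G * A11 = A21"
    using assoc_mult_mat[OF A21 G(1) A11] G(3) A21 by simp
  have AX: "A11 * (G * A12) = A12"
    using assoc_mult_mat[OF A11 G(1) A12] G(2) A12 by simp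
  have Y1: "\<bar>(A21 * G) $$ (i, r)\<bar> \<le> 1" if ir: "i < h" "r < k" for i r
  proof -
    have "mat k k (\<lambda>(a, b). A $$ (p (if a = r then k + i else a), q b)) =
        mat k k (\<lambda>(a, b). if a = r then A21 $$ (i, b) else A11 $$ (a, b))"
      using ir by (intro eq_matI) (auto simp: entry)
    then have "\<bar>det (mat k k (\<lambda>(a, b). if a = r then A21 $$ (i, b) else A11 $$ (a, b)))\<bar> \<le> \<bar>det A11\<bar>"
      using max(1)[OF exchange_upd exchange_id[OF k(2)], of "k + i" r] ir by simp
    moreover have "det (mat k k (\<lambda>(a, b). if a = r then A21 $$ (i, b) else A11 $$ (a, b))) =
        (A21 * G) $$ (i, r) * det A11"
      using det_replace_row_mult[OF A11 Y ir(2,1)] unfolding YA .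
    ultimately show ?thesis
      using det0 by (simp add: abs_mult)
  qed
  have X1: "\<bar>(G * A12) $$ (t, j)\<bar> \<le> 1" if tj: "t < k" "j < l" for t j
  proof -
    have "mat k k (\<lambda>(a, b). A $$ (p a, q (if b = t then k + j else b))) =
        mat k k (\<lambda>(a, b). if b = t then A12 $$ (a, j) else A11 $$ (a, b))"
      using tj by (intro eq_matI) (auto simp: entry)
    then have "\<bar>det (mat k k (\<lambda>(a, b). if b = t then A12 $$ (a, j) else A11 $$ (a, b)))\<bar> \<le> \<bar>det A11\<bar>"
      using max(1)[OF exchange_id[OF k(1)] exchange_upd, of "k + j" t] tj by simp
    moreover have "det (mat k k (\<lambda>(a, b). if b = t then A12 $$ (a, j) else A11 $$ (a, b))) =
        (G * A12) $$ (t, j) * det A11"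
      using det_replace_col_mult[OF A11 X tj] unfolding AX .
    ultimately show ?thesis
      using det0 by (simp add: abs_mult)
  qed
  have SG: "\<bar>(A22 - A21 * G * A12) $$ (i, j)\<bar> * \<bar>G $$ (t, r)\<bar> \<le> 2"
    if idx: "i < h" "j < l" "t < k" "r < k" for i j t r
  proof -
    define M where "M = mat k k (\<lambda>(a, b).
      if a = r then (if b = t then A22 $$ (i, j) else A21 $$ (i, b))
      else (if b = t then A12 $$ (a, j) else A11 $$ (a, b)))"
    define \<xi> where "\<xi> = (A21 * G) $$ (i, r) * (G * A12) $$ (t, j)"
    define \<zeta> where "\<zeta> = (A22 - A21 * G * A12) $$ (i, j) * G $$ (t, r)"
    have "mat k k (\<lambda>(a, b). A $$ (p (if a = r then k + i else a), q (if b = t then k + j else b))) = M"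
      unfolding M_def using idx by (intro eq_matI) (auto simp: entry)
    then have "\<bar>det M\<bar> \<le> \<bar>det A11\<bar>"
      using max(1)[OF exchange_upd exchange_upd, of "k + i" "k + j" r t] idx by simp
    moreover have "det M = det A11 * (\<xi> + \<zeta>)"
      unfolding M_def \<xi>_def \<zeta>_def
      by (rule det_exchange_row_col[OF A11 A12 A21 A22 G idx(4,3,1,2)])
    ultimately have "\<bar>\<xi> + \<zeta>\<bar> \<le> 1"
      using det0 by (simp add: abs_mult)
    moreover have "\<bar>\<xi>\<bar> \<le> 1 * 1"
      unfolding \<xi>_def abs_mult using Y1[OF idx(1,4)] X1[OF idx(3,2)] by (intro mult_mono) auto
    ultimately have "\<bar>\<zeta>\<bar> \<le> 2"
      by linarith
    then show ?thesis
      by (simp add: \<zeta>_def abs_mult)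
  qed
  show "max_norm (A21 * mat_inv A11) \<le> 1" "max_norm (mat_inv A11 * A12) \<le> 1"
    using max_norm_le[OF Y Y1] max_norm_le[OF X X1] by (simp_all add: G_def)
  show "max_norm (A22 - A21 * mat_inv A11 * A12) * max_norm (mat_inv A11) \<le> 2"
    using max_norm_mult_le[OF S G(1) _ SG] by (simp add: G_def)
qed

lemma sqrt_bounds:
  fixes k h l m n :: nat
  assumes "1 \<le> k" "m = k + h" "n = k + l"
  defines "q \<equiv> real k * sqrt (real m * real n)"
  shows "sqrt (real h * real k) \<le> q" "sqrt (real k * real l) \<le> q" "real k * sqrt (real h * real l) \<le> q"
    "sqrt (real k * real l) * sqrt (real h * real k) \<le> q"
proof -
  have hm: "real h \<le> real m" "real l \<le> real n" and k1: "1 \<le> real k" "1 \<le> real m" "1 \<le> real n"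
    using assms by auto
  have q: "q = sqrt ((real k * real k) * (real m * real n))"
    by (simp add: q_def real_sqrt_mult)
  have "real h * real k \<le> (real m * real n) * (real k * real k)"
    using hm k1 mult_mono[of "real h" "real m" 1 "real n"] mult_mono[of 1 "real k" "real k" "real k"]
    by (intro mult_mono) auto
  then show "sqrt (real h * real k) \<le> q"
    unfolding q by (simp add: mult_ac)
  have "real k * real l \<le> (real k * real k) * (real m * real n)"
    using hm k1 mult_mono[of 1 "real m" "real l" "real n"] mult_mono[of 1 "real k" "real k" "real k"]
    by (intro mult_mono) auto
  then show "sqrt (real k * real l) \<le> q"
    unfolding q by simp
  show *: "real k * sqrt (real h * real l) \<le> q"
    unfolding q_def using hm by (intro mult_left_mono real_sqrt_le_mono mult_mono) auto
  have "sqrt (real k * real l) * sqrt (real h * real k) = real k * sqrt (real h * real l)"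
    by (simp add: real_sqrt_mult)
  then show "sqrt (real k * real l) * sqrt (real h * real k) \<le> q"
    using * by simp
qed

theorem theorem3p1:
  fixes m n k :: nat
    and A P1 P2 A11 A12 A21 A22 Ak :: "real mat"
    and I J :: "nat set"
    and p q :: "nat \<Rightarrow> nat"
    and \<mu> :: real
  assumes "m \<ge> 1" and "n \<ge> 1" and "1 \<le> k" and "k \<le> min m n"
    and "A \<in> carrier_mat m n"
    and "card I = k" and "card J = k" and "local_max_vol A I J"
    and "p permutes {..<m}" and "p ` {..<k} = I" and "P1 = perm_mat m p"
    and "q permutes {..<n}" and "q ` {..<k} = J" and "P2 = transpose_mat (perm_mat n q)"
    and "A11 \<in> carrier_mat k k" and "A12 \<in> carrier_mat k (n - k)"
    and "A21 \<in> carrier_mat (m - k) k" and "A22 \<in> carrier_mat (m - k) (n - k)"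
    and "P1 * A * P2 = four_block_mat A11 A12 A21 A22"
    and "Ak = mat_inv P1 * four_block_mat A11 A12 A21 (A21 * mat_inv A11 * A12) * mat_inv P2"
    and "\<mu> = 1 + 5 * real k * sqrt (real m * real n)"
  shows "P1 * A * P2 =
           four_block_mat (1\<^sub>m k) (0\<^sub>m k (m - k)) (A21 * mat_inv A11) (1\<^sub>m (m - k)) *
           four_block_mat A11 A12 (0\<^sub>m (m - k) k) (A22 - A21 * mat_inv A11 * A12)
       \<and> vec_space.rank m Ak \<le> k
       \<and> (\<forall>j. 1 \<le> j \<and> j \<le> k \<longrightarrow>
            1 / \<mu> * sing_val A j \<le> sing_val Ak j \<and> sing_val Ak j \<le> \<mu> * sing_val A j)
       \<and> (\<forall>j. 1 \<le> j \<and> j \<le> min m n - k \<longrightarrow>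
            1 / \<mu> * sing_val A (k + j) \<le> sing_val (A - Ak) j \<and>
            sing_val (A - Ak) j \<le> \<mu> * sing_val A (k + j))
       \<and> max_norm (A21 * mat_inv A11) \<le> 1
       \<and> max_norm (mat_inv A11 * A12) \<le> 1"
proof -
  define h l where "h = m - k" and "l = n - k"
  have m: "m = k + h" and n: "n = k + l"
    using assms(4) by (auto simp: h_def l_def)
  note A = assms(5) and p = assms(9) and q = assms(12) and P1 = assms(11) and P2 = assms(14)
  note blk = assms(15-18)[folded h_def l_def]
  note lmv = assms(8)[folded assms(10) assms(13)]
  note bounds = max_norm_bounds_of_local_max_vol[OF A[unfolded m n] lmv p[unfolded m] q[unfolded n] blk
      assms(19)[unfolded P1 P2 m n]]
  define G where "G = mat_inv A11"
  note G = mat_inv[OF blk(1) bounds(1), folded G_def]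
  note bnd = bounds(2-4)[folded G_def]
  define S where "S = A22 - A21 * G * A12"
  have Yc: "A21 * G \<in> carrier_mat h k" and Xc: "G * A12 \<in> carrier_mat k l" and Sc: "S \<in> carrier_mat h l"
    using blk G(1) by (auto simp: S_def)
  define a b where "a = sqrt (real h * real k)" and "b = sqrt (real k * real l)"
  define s g where "s = max_norm S * sqrt (real h * real l)" and "g = max_norm G * real k"
  have S0: "0 \<le> max_norm S" and G0: "0 \<le> max_norm G"
    using max_norm_nonneg[OF Sc] max_norm_nonneg[OF G(1)] by auto
  interpret be: block_elimination k h l A11 A12 A21 A22 G a b s g
  proof
    show "0 \<le> a" "0 \<le> b" "0 \<le> s" "0 \<le> g"
      using S0 G0 by (simp_all add: a_def b_def s_def g_def)
    show "vnorm ((A21 * G) *\<^sub>v x) \<le> a * vnorm x" if "x \<in> carrier_vec k" for x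
      using vnorm_mult_mat_vec_le[OF Yc that, of 1] max_norm_upper[OF Yc] bnd(1)
      by (fastforce simp: a_def)
    show "vnorm ((G * A12) *\<^sub>v w) \<le> b * vnorm w" if "w \<in> carrier_vec l" for w
      using vnorm_mult_mat_vec_le[OF Xc that, of 1] max_norm_upper[OF Xc] bnd(2)
      by (fastforce simp: b_def)
    show "vnorm ((A22 - A21 * G * A12) *\<^sub>v w) \<le> s * vnorm w" if "w \<in> carrier_vec l" for w
      using vnorm_mult_mat_vec_le[OF Sc that max_norm_upper[OF Sc] S0]
      by (simp add: s_def S_def)
    show "vnorm (G *\<^sub>v x) \<le> g * vnorm x" if "x \<in> carrier_vec k" for x
      using vnorm_mult_mat_vec_le[OF G(1) that max_norm_upper[OF G(1)] G0]
      by (simp add: g_def)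
  qed (use blk G assms(3) in auto)
  have B: "P1 * A * P2 = be.B"
    unfolding be.B_def by (rule assms(19))
  have P1c: "P1 \<in> carrier_mat m m" and P2c: "P2 \<in> carrier_mat n n"
    by (simp_all add: P1 P2)
  have orth: "transpose_mat P1 * P1 = 1\<^sub>m m" "transpose_mat P2 * P2 = 1\<^sub>m n"
    using perm_mat_orthogonal(2)[OF p] perm_mat_orthogonal(1)[OF q] by (simp_all add: P1 P2)
  have "det (transpose_mat P1) * det P1 = 1" "det (transpose_mat P2) * det P2 = 1"
    using orth P1c P2c by (simp_all flip: det_mult[of _ m] det_mult[of _ n])
  then have "det P1 \<noteq> 0" "det P2 \<noteq> 0"
    by auto
  note i1 = mat_inv[OF P1c this(1)] and i2 = mat_inv[OF P2c this(2)]
  have C: "be.C \<in> carrier_mat m n"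
    using be.carriers(5) by (simp add: m n)
  have Ak: "Ak = mat_inv P1 * be.C * mat_inv P2"
    using assms(20)[folded G_def] unfolding be.C_def .
  have i1C: "mat_inv P1 * be.C \<in> carrier_mat m n"
    using i1(1) C by simp
  have Akc: "Ak \<in> carrier_mat m n"
    unfolding Ak using i1C i2(1) by simp
  have "P1 * Ak = be.C * mat_inv P2"
    unfolding Ak assoc_mult_mat[OF i1(1) C i2(1)]
    using assoc_mult_mat[OF P1c i1(1) mult_carrier_mat[OF C i2(1)]] i1(2) C i2(1) by simp
  then have PAkP: "P1 * Ak * P2 = be.C"
    using assoc_mult_mat[OF C i2(1) P2c] i2(3) C by simp
  have "P1 * (A - Ak) * P2 = P1 * A * P2 - P1 * Ak * P2"
    using P1c P2c A Akc
    by (simp add: mult_minus_distrib_mat[of _ m m] minus_mult_distrib_mat[of _ m n])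
  then have PEP: "P1 * (A - Ak) * P2 = be.E"
    by (simp add: B PAkP be.B_minus_C)
  have AAk: "A - Ak \<in> carrier_mat m n"
    using Akc by (rule minus_carrier_mat)
  have svA: "sing_val A j = sing_val be.B j" and svAk: "sing_val Ak j = sing_val be.C j"
    and svE: "sing_val (A - Ak) j = sing_val be.E j" for j
    using sing_val_orthogonal_invariant[OF A P1c orth(1) P2c orth(2)]
      sing_val_orthogonal_invariant[OF Akc P1c orth(1) P2c orth(2)]
      sing_val_orthogonal_invariant[OF AAk P1c orth(1) P2c orth(2)]
    by (simp_all add: B PAkP PEP)
  have nn: "0 \<le> sing_val be.B j" "0 \<le> sing_val be.C j" "0 \<le> sing_val be.E j" for j
    using be.carriers(4-6) by (auto intro: sing_val_nonneg)
  \<comment> \<open>all constants are expressed through \<open>\<theta>\<close>; the factor 5 is \<open>2\<close> from \<open>s * g\<close> plus one each from \<open>a\<close>, \<open>b\<close> and \<open>b * a\<close>\<close>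
  define \<theta> where "\<theta> = real k * sqrt (real m * real n)"
  have \<theta>: "a \<le> \<theta>" "b \<le> \<theta>" "real k * sqrt (real h * real l) \<le> \<theta>" "b * a \<le> \<theta>"
    using sqrt_bounds[OF assms(3) m n] by (simp_all add: \<theta>_def a_def b_def)
  have \<mu>: "\<mu> = 1 + 5 * \<theta>"
    by (simp add: assms(21) \<theta>_def)
  have "s * g = (max_norm S * max_norm G) * (real k * sqrt (real h * real l))"
    by (simp add: s_def g_def)
  also have "\<dots> \<le> 2 * \<theta>"
    using bnd(3) \<theta>(3) S0 G0 by (intro mult_mono) (auto simp: S_def)
  finally have sg: "s * g \<le> 2 * \<theta>" .
  have \<theta>0: "0 \<le> \<theta>"
    by (simp add: \<theta>_def)
  then have \<mu>1: "1 \<le> \<mu>"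
    by (simp add: \<mu>)
  have up: "1 / \<mu> * x \<le> y" if "x \<le> c * y" "c \<le> \<mu>" "0 \<le> y" for x y c
  proof -
    have "x \<le> \<mu> * y"
      using that mult_right_mono[of c \<mu> y] by linarith
    then show ?thesis
      using \<mu>1 by (simp add: field_simps)
  qed
  have down: "x \<le> \<mu> * y" if "x \<le> c * y" "c \<le> \<mu>" "0 \<le> y" for x y c
    using that mult_right_mono[of c \<mu> y] by linarith
  have lu: "P1 * A * P2 =
      four_block_mat (1\<^sub>m k) (0\<^sub>m k (m - k)) (A21 * mat_inv A11) (1\<^sub>m (m - k)) *
      four_block_mat A11 A12 (0\<^sub>m (m - k) k) (A22 - A21 * mat_inv A11 * A12)"
    using be.B_lu_factorisation
    unfolding B be.Y_def be.S_def unfolding G_def h_def .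
  have rank: "vec_space.rank m Ak \<le> k"
  proof -
    obtain K L where K: "K \<in> carrier_mat (k + h) k" and L: "L \<in> carrier_mat k (k + l)"
      and KL: "be.C = K * L"
      using be.C_factorisation .
    note K = K[folded m] and L = L[folded n]
    have "Ak = mat_inv P1 * K * (L * mat_inv P2)"
      unfolding Ak KL
      unfolding assoc_mult_mat[OF i1(1) K L, symmetric]
      by (rule assoc_mult_mat[OF mult_carrier_mat[OF i1(1) K] L i2(1)])
    then show ?thesis
      using vec_space.rank_mult_le[of "mat_inv P1 * K" m k "L * mat_inv P2" n] i1(1) i2(1) K L
      by simp
  qed
  have small: "1 / \<mu> * sing_val A j \<le> sing_val Ak j \<and> sing_val Ak j \<le> \<mu> * sing_val A j"
    if j: "1 \<le> j" "j \<le> k" for j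
  proof
    show "1 / \<mu> * sing_val A j \<le> sing_val Ak j"
      unfolding svA svAk
      by (rule up[OF be.sing_val_B_le_C[OF j]]) (use sg \<theta>0 nn \<mu> in auto)
    show "sing_val Ak j \<le> \<mu> * sing_val A j"
      unfolding svA svAk
      by (rule down[OF be.sing_val_C_le_B]) (use j \<theta> \<theta>0 nn \<mu> in auto)
  qed
  have large: "1 / \<mu> * sing_val A (k + j) \<le> sing_val (A - Ak) j \<and>
      sing_val (A - Ak) j \<le> \<mu> * sing_val A (k + j)"
    if j: "1 \<le> j" "j \<le> min m n - k" for j
  proof
    have j': "j \<le> min h l"
      using j(2) by (auto simp: m n)
    show "1 / \<mu> * sing_val A (k + j) \<le> sing_val (A - Ak) j"
      unfolding svA svE
      using be.sing_val_B_le_E[OF j(1) j'] by (intro up[of _ 1]) (use nn \<mu>1 in auto)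
    have "s * g + (1 + b) * (1 + a) \<le> \<mu>"
      using sg \<theta> unfolding \<mu> by (simp add: algebra_simps)
    then show "sing_val (A - Ak) j \<le> \<mu> * sing_val A (k + j)"
      unfolding svA svE by (rule down[OF be.sing_val_E_le_B[OF j(1) j']]) (rule nn)
  qed
  show ?thesis
    using lu rank small large bounds(2,3) by blast
qed

end
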